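(* Let $L/\mathbb{F}_q$ be a field extension, complete for a valuation $\nu:L\to\mathbb{Q}\cup\{\infty\}$; let $\Sigma\subset\mathbb{N}^*$ be finite and let $\delta_i:A\to L$ ($i\in\Sigma$) and $\gamma:A\to L$ be injective $\mathbb{F}_q$-linear maps such that $\nu(\delta_i(a))\in\{0,\infty\}$ for all $i\in\Sigma$, $a\in A$, and $\gamma(a)^{-1}\to0$ as $a$ runs in $A\setminus\{0\}$. For all $m,n>0$ and all semi-characters $\sigma,\psi$ we have $$\mathcal{F}_m^\sigma\,\mathcal{F}_n^\psi\subset\mathcal{F}^{\sigma\psi}_{m+n},$$ and the $\mathbb{F}_p$-vector space $\mathcal{F}=\sum_{n,\sigma}\mathcal{F}_n^\sigma$ is an $\mathbb{F}_p$-algebra.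
   Context: $q$ is a power of a prime $p$, $A=\mathbb{F}_q[\theta]$, $A^+$ the set of monic polynomials of $A$. Write $\gamma_a=\gamma(a)$. A semi-character is a map $A\to L$ of the form $a\mapsto\prod_{i\in\Sigma}\delta_i(a)^{\alpha_i}$ with $\alpha_i\in\mathbb{N}$; $\boldsymbol{1}$ is the trivial one, constant equal to $1$. For semi-characters $\sigma_1,\dots,\sigma_r$ and integers $n_1,\dots,n_r\ge1$, $$f_A\begin{pmatrix} \sigma_1 & \cdots & \sigma_r \\ n_1 & \cdots & n_r \end{pmatrix}=\sum\frac{\sigma_1(a_1)\cdots\sigma_r(a_r)}{\gamma_{a_1}^{n_1}\cdots\gamma_{a_r}^{n_r}}\in L,$$ the (convergent) sum being over $a_1,\dots,a_r\in A^+$ with $\deg_\theta(a_1)>\cdots>\deg_\theta(a_r)\ge0$. For $n>0$ and a semi-character $\sigma$, $\mathcal{F}^\sigma_n$ is the $\mathbb{F}_p$-subspace of $L$ generated by the elements $f_A\begin{pmatrix} \sigma_1 & \cdots & \sigma_r \\ n_1 & \cdots & n_r \end{pmatrix}$ with $r>0$, $\prod_i\sigma_i=\sigma$, $\sum_in_i=n$, all $n_i>0$. Also $\mathcal{F}_0^{\boldsymbol{1}}=\mathbb{F}_p$ and $\mathcal{F}^\sigma_0=(0)$ if $\sigma\ne\boldsymbol{1}$. *)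

theory Defs
  imports
    "HOL-Analysis.Analysis"
    "HOL-Library.Extended"
    "HOL-Computational_Algebra.Computational_Algebra"
begin

section \<open>Valued fields\<close>

text \<open>
  The value \<open>\<infinity>\<close> is \<open>Pinf\<close>; the spurious element \<open>Minf\<close> of the library type is excluded,
  so that values lie in \<open>\<rat> \<union> {\<infinity>}\<close>.
\<close>

definition valuation :: "('l::field \<Rightarrow> rat extended) \<Rightarrow> bool" where
  "valuation \<nu> \<longleftrightarrow>
     (\<forall>x. \<nu> x \<noteq> Minf) \<and>
     (\<forall>x. \<nu> x = Pinf \<longleftrightarrow> x = 0) \<and>
     (\<forall>x y. \<nu> (x * y) = \<nu> x + \<nu> y) \<and>
     (\<forall>x y. min (\<nu> x) (\<nu> y) \<le> \<nu> (x + y))"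

text \<open>
  The ultrametric \<open>2 powr - \<nu> (x - y)\<close>. Its topology and its Cauchy sequences are those of
  \<open>\<nu>\<close> and do not depend on the choice of the base \<open>2\<close>.
\<close>

definition val_dist :: "('l::field \<Rightarrow> rat extended) \<Rightarrow> 'l \<Rightarrow> 'l \<Rightarrow> real" where
  "val_dist \<nu> x y = (case \<nu> (x - y) of Fin r \<Rightarrow> 2 powr (- of_rat r) | _ \<Rightarrow> 0)"

abbreviation val_topology :: "('l::field \<Rightarrow> rat extended) \<Rightarrow> 'l topology" where
  "val_topology \<nu> \<equiv> Metric_space.mtopology UNIV (val_dist \<nu>)"

abbreviation val_complete :: "('l::field \<Rightarrow> rat extended) \<Rightarrow> bool" where
  "val_complete \<nu> \<equiv> Metric_space.mcomplete UNIV (val_dist \<nu>)"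

lemma Metric_space_val_dist:
  assumes "valuation \<nu>"
  shows "Metric_space UNIV (val_dist \<nu>)"
proof -
  have inf: "\<nu> x \<noteq> Minf" and zero: "\<nu> x = Pinf \<longleftrightarrow> x = 0"
    and mult: "\<nu> (x * y) = \<nu> x + \<nu> y" and add: "min (\<nu> x) (\<nu> y) \<le> \<nu> (x + y)" for x y
    using assms by (auto simp: valuation_def)
  have m1: "\<nu> (-1) = Fin 0"
  proof -
    obtain r where r: "\<nu> (-1) = Fin r"
      using inf[of "-1"] zero[of "-1"] by (cases "\<nu> (-1)") auto
    obtain s where s: "\<nu> 1 = Fin s"
      using inf[of 1] zero[of 1] by (cases "\<nu> 1") auto
    from mult[of 1 1] s mult[of "-1" "-1"] r show ?thesis by simp
  qed
  have neg: "\<nu> (- x) = \<nu> x" for x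
    using mult[of "-1" x] m1 inf[of x] by (cases "\<nu> x") auto
  show ?thesis
  proof
    fix x y :: 'a
    show "0 \<le> val_dist \<nu> x y" by (auto simp: val_dist_def split: extended.splits)
    show "val_dist \<nu> x y = val_dist \<nu> y x"
      using neg[of "x - y"] by (simp add: val_dist_def)
    show "val_dist \<nu> x y = 0 \<longleftrightarrow> x = y"
      using inf[of "x - y"] zero[of "x - y"] by (auto simp: val_dist_def split: extended.splits)
  next
    fix x y z :: 'a
    have m: "min (\<nu> (x - y)) (\<nu> (y - z)) \<le> \<nu> (x - z)"
      using add[of "x - y" "y - z"] by simp
    have nn: "0 \<le> val_dist \<nu> x y" "0 \<le> val_dist \<nu> y z"
      by (auto simp: val_dist_def split: extended.splits)
    have "val_dist \<nu> x z \<le> max (val_dist \<nu> x y) (val_dist \<nu> y z)"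
      using m inf[of "x - y"] inf[of "y - z"] inf[of "x - z"]
      by (auto simp: val_dist_def min_def max_def of_rat_less_eq split: extended.splits if_splits)
    then show "val_dist \<nu> x z \<le> val_dist \<nu> x y + val_dist \<nu> y z"
      using nn by linarith
  qed
qed

text \<open>Unconditional sum: limit of the finite partial sums, as in \<open>has_sum\<close>.\<close>

definition val_has_sum ::
  "('l::field \<Rightarrow> rat extended) \<Rightarrow> ('i \<Rightarrow> 'l) \<Rightarrow> 'i set \<Rightarrow> 'l \<Rightarrow> bool" where
  "val_has_sum \<nu> f S l \<longleftrightarrow> limitin (val_topology \<nu>) (sum f) l (finite_subsets_at_top S)"

definition val_infsum :: "('l::field \<Rightarrow> rat extended) \<Rightarrow> ('i \<Rightarrow> 'l) \<Rightarrow> 'i set \<Rightarrow> 'l" where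
  "val_infsum \<nu> f S = (THE l. val_has_sum \<nu> f S l)"


section \<open>Linear algebra over the prime field\<close>

text \<open>
  When the field has characteristic \<open>p > 0\<close>, the image of \<open>\<int>\<close> is its subfield with
  \<open>p\<close> elements.
\<close>

definition Fp :: "'l::field set" where
  "Fp = range of_int"

definition Fp_subspace :: "'l::field set \<Rightarrow> bool" where
  "Fp_subspace V \<longleftrightarrow>
     0 \<in> V \<and> (\<forall>x\<in>V. \<forall>y\<in>V. x + y \<in> V) \<and> (\<forall>c\<in>Fp. \<forall>x\<in>V. c * x \<in> V)"

definition Fp_span :: "'l::field set \<Rightarrow> 'l set" where
  "Fp_span S = Fp_subspace hull S"

definition Fp_subalgebra :: "'l::field set \<Rightarrow> bool" where
  "Fp_subalgebra V \<longleftrightarrow> Fp_subspace V \<and> 1 \<in> V \<and> (\<forall>x\<in>V. \<forall>y\<in>V. x * y \<in> V)"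


section \<open>Semi-characters and multiple sums\<close>

definition field_embedding :: "('k::field \<Rightarrow> 'l::field) \<Rightarrow> bool" where
  "field_embedding \<iota> \<longleftrightarrow>
     \<iota> 1 = 1 \<and> (\<forall>x y. \<iota> (x + y) = \<iota> x + \<iota> y) \<and> (\<forall>x y. \<iota> (x * y) = \<iota> x * \<iota> y)"

definition semi_characters :: "nat set \<Rightarrow> (nat \<Rightarrow> 'k::field poly \<Rightarrow> 'l::field) \<Rightarrow>
    ('k poly \<Rightarrow> 'l) set" where
  "semi_characters I \<delta> = {\<lambda>a. \<Prod>i\<in>I. \<delta> i a ^ \<alpha> i | \<alpha> :: nat \<Rightarrow> nat. True}"

definition monic_chains :: "nat \<Rightarrow> 'k::field poly list set" where
  "monic_chains r =
     {as. length as = r \<and> (\<forall>a\<in>set as. lead_coeff a = 1) \<and>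
          sorted_wrt (\<lambda>a b. degree a > degree b) as}"

definition f_A :: "('l::field \<Rightarrow> rat extended) \<Rightarrow> ('k::field poly \<Rightarrow> 'l) \<Rightarrow>
    ('k poly \<Rightarrow> 'l) list \<Rightarrow> nat list \<Rightarrow> 'l" where
  "f_A \<nu> \<gamma> \<sigma>s ns =
     val_infsum \<nu>
       (\<lambda>as. (\<Prod>j<length \<sigma>s. (\<sigma>s ! j) (as ! j)) / (\<Prod>j<length \<sigma>s. \<gamma> (as ! j) ^ (ns ! j)))
       (monic_chains (length \<sigma>s))"

definition F_space :: "('l::field \<Rightarrow> rat extended) \<Rightarrow> nat set \<Rightarrow> (nat \<Rightarrow> 'k::field poly \<Rightarrow> 'l) \<Rightarrow>
    ('k poly \<Rightarrow> 'l) \<Rightarrow> nat \<Rightarrow> ('k poly \<Rightarrow> 'l) \<Rightarrow> 'l set" where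
  "F_space \<nu> I \<delta> \<gamma> n \<sigma> =
     (if n = 0 then (if \<sigma> = (\<lambda>a. 1) then Fp else {0})
      else Fp_span {f_A \<nu> \<gamma> \<sigma>s ns | \<sigma>s ns.
             \<sigma>s \<noteq> [] \<and> length ns = length \<sigma>s \<and> set \<sigma>s \<subseteq> semi_characters I \<delta> \<and>
             (\<lambda>a. \<Prod>j<length \<sigma>s. (\<sigma>s ! j) a) = \<sigma> \<and> sum_list ns = n \<and> (\<forall>k\<in>set ns. k > 0)})"

text \<open>The sum of the subspaces \<open>F_space \<nu> I \<delta> \<gamma> n \<sigma>\<close> over all \<open>n \<ge> 0\<close> and all
  semi-characters \<open>\<sigma>\<close>.\<close>

definition F_total :: "('l::field \<Rightarrow> rat extended) \<Rightarrow> nat set \<Rightarrow> (nat \<Rightarrow> 'k::field poly \<Rightarrow> 'l) \<Rightarrow>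
    ('k poly \<Rightarrow> 'l) \<Rightarrow> 'l set" where
  "F_total \<nu> I \<delta> \<gamma> = Fp_span (\<Union>n. \<Union>\<sigma>\<in>semi_characters I \<delta>. F_space \<nu> I \<delta> \<gamma> n \<sigma>)"

end

theory Submission
  imports Defs "HOL-Library.Function_Algebras"
begin

text \<open>
  Write \<open>S\<^sub>d(\<sigma>; n)\<close> for the sum of \<open>\<sigma> a / \<gamma> a ^ n\<close> over the monic polynomials \<open>a\<close> of degree \<open>d\<close>.
  In \<open>S\<^sub>d(\<sigma>; m) * S\<^sub>d(\<psi>; n)\<close> the diagonal terms add up to \<open>S\<^sub>d(\<sigma>\<psi>; m + n)\<close>. For \<open>a \<noteq> b\<close>, the
  partial fraction expansion of \<open>1 / (\<gamma> a ^ m * \<gamma> b ^ n)\<close> replaces one of \<open>\<gamma> a\<close>, \<open>\<gamma> b\<close> by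
  \<open>\<gamma> (b - a)\<close>, where \<open>c = b - a\<close> runs over the nonzero polynomials of degree less than \<open>d\<close>;
  expanding \<open>\<psi> (a + c)\<close> by the binomial theorem and writing \<open>c\<close> as a scalar times a monic
  polynomial, whose scalar contributes a character sum over the units of the finite field lying in
  the prime field, one gets an \<open>F\<^sub>p\<close>-combination, with coefficients independent of \<open>d\<close>, of products
  \<open>S\<^sub>d(\<alpha>; i) * (\<Sum>e<d. S\<^sub>e(\<beta>; j))\<close> with \<open>\<alpha>\<beta> = \<sigma>\<psi>\<close>, \<open>i + j = m + n\<close>.
  Induction on the total depth extends this to products of truncated multiple sums, and letting the
  truncation degree tend to infinity gives the theorem.
\<close>

section \<open>Additive closures and prime field spans\<close>

text \<open>The closure is built from \<open>0\<close> and \<open>S\<close> by differences alone, so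
  a map preserving differences needs checking only on generators. Later closure arguments mostly
  reduce to this induction.\<close>

lemma group_closure_hom:
  fixes h :: "'a::ab_group_add \<Rightarrow> 'b::ab_group_add"
  assumes "x \<in> group_closure S" and diff: "\<And>x y. h (x - y) = h x - h y"
    and "\<And>s. s \<in> S \<Longrightarrow> h s \<in> group_closure T"
  shows "h x \<in> group_closure T"
  using assms(1)
proof induction
  case (base s)
  have "h 0 = 0" using diff[of 0 0] by simp
  with base assms(3) show ?case by auto
qed (auto simp: diff intro: group_closure.diff)

lemma group_closure_superset: "s \<in> S \<Longrightarrow> s \<in> group_closure S"
  by (simp add: group_closure.base)

lemma group_closure_mono:
  assumes "S \<subseteq> T" "x \<in> group_closure S"
  shows "x \<in> group_closure T"
  using group_closure_hom[of x S "\<lambda>x. x" T] assms by (auto intro: group_closure_superset)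

text \<open>Two applications of \<open>group_closure_hom\<close>, using additivity of the product in
  each factor separately.\<close>

lemma group_closure_mult:
  fixes x y :: "'a::ring"
  assumes x: "x \<in> group_closure S" and y: "y \<in> group_closure T"
    and st: "\<And>s t. s \<in> S \<Longrightarrow> t \<in> T \<Longrightarrow> s * t \<in> group_closure U"
  shows "x * y \<in> group_closure U"
proof (rule group_closure_hom[OF x, where h = "\<lambda>x. x * y"])
  fix s assume "s \<in> S"
  then show "s * y \<in> group_closure U"
    by (intro group_closure_hom[OF y, where h = "\<lambda>y. s * y"]) (auto simp: algebra_simps st)
qed (simp add: algebra_simps)

lemma group_closure_sum:
  "(\<And>i. i \<in> J \<Longrightarrow> f i \<in> group_closure S) \<Longrightarrow> sum f J \<in> group_closure S"
  by (induction J rule: infinite_finite_induct) (auto intro: group_closure_add)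

lemma group_closure_of_int_mult:
  fixes x :: "'a::comm_ring_1"
  assumes "x \<in> group_closure S"
  shows "of_int k * x \<in> group_closure S"
  using group_closure_scalar_mult_left[OF assms] by (cases k rule: int_cases2) simp_all

lemma of_int_fun_apply: "(of_int k :: 'a \<Rightarrow> 'b::ring_1) x = of_int k"
  by (cases k rule: int_cases2) simp_all

text \<open>An element of \<open>Fp\<close> is the image of an integer, so scaling by it is repeated
  addition or subtraction. The scalar is the same at every argument; in the applications the
  argument is a degree.\<close>

lemma group_closure_Fp_mult:
  fixes f :: "'a \<Rightarrow> 'l::field"
  assumes "f \<in> group_closure S" and "c \<in> Fp"
  shows "(\<lambda>x. c * f x) \<in> group_closure S"
proof -
  obtain k where "c = of_int k" using assms(2) by (auto simp: Fp_def)
  then have "(\<lambda>x. c * f x) = of_int k * f" by (simp add: fun_eq_iff of_int_fun_apply)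
  then show ?thesis using group_closure_of_int_mult[OF assms(1)] by simp
qed

text \<open>Since \<open>Fp\<close> is the image of the integers, its subspaces are exactly the
  additive subgroups. The additive closure also makes sense for sequences with values in the field,
  which do not themselves form a field.\<close>

lemma Fp_span_eq_group_closure: "Fp_span S = group_closure S"
  unfolding Fp_span_def
proof (rule hull_unique)
  show "S \<subseteq> group_closure S" by (auto intro: group_closure_superset)
  show "Fp_subspace (group_closure S)"
    by (auto simp: Fp_subspace_def Fp_def intro: group_closure_add group_closure_of_int_mult)
next
  fix V assume V: "S \<subseteq> V" "Fp_subspace V"
  have "- 1 \<in> (Fp :: 'a set)" unfolding Fp_def by (rule range_eqI[of _ _ "- 1"]) simp
  then have diff: "x - y \<in> V" if "x \<in> V" "y \<in> V" for x y
    using V(2) that unfolding Fp_subspace_def by (metis diff_conv_add_uminus mult_minus1)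
  show "group_closure S \<subseteq> V"
  proof
    fix x assume "x \<in> group_closure S"
    then show "x \<in> V"
      by induction (use V in \<open>auto simp: Fp_subspace_def intro: diff\<close>)
  qed
qed

lemma sum_fun_apply: "sum f J x = (\<Sum>i\<in>J. f i x)"
  by (induction J rule: infinite_finite_induct) auto

text \<open>Split the pairs of indices according to whether the first is larger, the second is
  larger, or both agree; \<open>e\<close> is the larger one.\<close>

lemma sum_lessThan_mult_sum_lessThan:
  fixes f g :: "nat \<Rightarrow> 'a::comm_ring"
  shows "sum f {..<d} * sum g {..<d} =
    (\<Sum>e<d. f e * sum g {..<e} + g e * sum f {..<e} + f e * g e)"
  by (induction d) (auto simp: algebra_simps)

section \<open>Monic polynomials over a finite field\<close>

lemma finite_degree_less: "finite {a :: 'k::{zero,finite} poly. degree a < d}"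
proof -
  have "finite (Poly ` {xs :: 'k list. set xs \<subseteq> UNIV \<and> length xs \<le> d})"
    by (intro finite_imageI finite_lists_length_le) simp
  moreover have "{a :: 'k poly. degree a < d} \<subseteq> Poly ` {xs. set xs \<subseteq> UNIV \<and> length xs \<le> d}"
  proof
    fix a :: "'k poly" assume "a \<in> {a. degree a < d}"
    then have "length (coeffs a) \<le> d" by (auto simp: coeffs_def)
    then show "a \<in> Poly ` {xs. set xs \<subseteq> UNIV \<and> length xs \<le> d}"
      by (intro image_eqI[of _ _ "coeffs a"]) auto
  qed
  ultimately show ?thesis by (rule rev_finite_subset)
qed

definition monics :: "nat \<Rightarrow> 'k::field poly set" where
  "monics d = {a. lead_coeff a = 1 \<and> degree a = d}"

lemma finite_monics [simp]: "finite (monics d :: 'k::{field,finite} poly set)"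
  by (rule finite_subset[OF _ finite_degree_less[of "Suc d"]]) (auto simp: monics_def)

lemma monics_nonzero: "a \<in> monics d \<Longrightarrow> a \<noteq> 0"
  by (auto simp: monics_def)

text \<open>The leading terms of two monic polynomials of equal degree cancel in the difference, and
  adding a polynomial of lower degree keeps the leading term.\<close>

lemma bij_betw_monic_pairs:
  "bij_betw (\<lambda>(a, c). (a, a + c)) (monics d \<times> {c. c \<noteq> 0 \<and> degree c < d})
     {(a, b). a \<in> monics d \<and> b \<in> monics d \<and> a \<noteq> (b :: 'k::field poly)}"
proof (rule bij_betw_byWitness[where f' = "\<lambda>(a, b). (a, b - a)"])
  show "(\<lambda>(a, c). (a, a + c)) ` (monics d \<times> {c :: 'k poly. c \<noteq> 0 \<and> degree c < d})
    \<subseteq> {(a, b). a \<in> monics d \<and> b \<in> monics d \<and> a \<noteq> b}"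
    by (auto simp: monics_def degree_add_eq_left coeff_eq_0)
  show "(\<lambda>(a, b). (a, b - a)) ` {(a, b). a \<in> monics d \<and> b \<in> monics d \<and> a \<noteq> (b :: 'k poly)}
    \<subseteq> monics d \<times> {c. c \<noteq> 0 \<and> degree c < d}"
  proof -
    have "degree (b - a) < d" if "a \<in> monics d" "b \<in> monics d" "a \<noteq> b" for a b :: "'k poly"
    proof -
      have "degree (b - a) \<le> d" "coeff (b - a) d = 0"
        using that by (auto simp: monics_def intro: degree_diff_le)
      then have "b - a = 0 \<or> degree (b - a) < d" by (rule eq_zero_or_degree_less)
      with that show ?thesis by auto
    qed
    then show ?thesis by auto
  qed
qed auto

lemma bij_betw_smult_monics:
  "bij_betw (\<lambda>(l, c). smult l c) ((UNIV - {0}) \<times> (\<Union>e<d. monics e))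
     {c :: 'k::field poly. c \<noteq> 0 \<and> degree c < d}"
  by (rule bij_betw_byWitness[where f' = "\<lambda>c. (lead_coeff c, smult (inverse (lead_coeff c)) c)"])
    (auto simp: monics_def)

text \<open>Either the multiplicative character \<open>x \<mapsto> \<iota> x ^ s / \<iota> x ^ k\<close> is trivial or its sum vanishes.\<close>

lemma sum_units_power_ratio_in_Fp:
  fixes \<iota> :: "'k::{field,finite} \<Rightarrow> 'l::field"
  assumes "field_embedding \<iota>"
  shows "(\<Sum>x\<in>UNIV - {0}. \<iota> x ^ s / \<iota> x ^ k) \<in> Fp"
proof -
  let ?f = "\<lambda>x. \<iota> x ^ s / \<iota> x ^ k"
  have one: "\<iota> 1 = 1" and mult: "\<iota> (x * y) = \<iota> x * \<iota> y" for x y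
    using assms by (auto simp: field_embedding_def)
  have fm: "?f (x * y) = ?f x * ?f y" for x y by (simp add: mult power_mult_distrib)
  show ?thesis
  proof (cases "\<forall>x\<in>UNIV - {0}. ?f x = 1")
    case True
    then have "(\<Sum>x\<in>UNIV - {0}. ?f x) = of_int (int (card (UNIV - {0 :: 'k})))"
      by (subst sum.cong[OF refl, of _ _ "\<lambda>_. 1"]) auto
    then show ?thesis unfolding Fp_def by (metis rangeI)
  next
    case False
    then obtain y where y: "y \<noteq> 0" "?f y \<noteq> 1" by auto
    \<comment> \<open>Multiplication by \<open>y\<close> permutes the units, so the sum is
      multiplied by \<open>?f y\<close>, which differs from 1, and yet stays the same.\<close>
    have "(\<Sum>x\<in>UNIV - {0}. ?f x) = (\<Sum>x\<in>UNIV - {0}. ?f (y * x))"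
      by (rule sum.reindex_bij_witness[of _ "\<lambda>x. y * x" "\<lambda>x. x / y"]) (use y in auto)
    also have "\<dots> = ?f y * (\<Sum>x\<in>UNIV - {0}. ?f x)"
      by (simp only: fm sum_distrib_left)
    finally have "(1 - ?f y) * (\<Sum>x\<in>UNIV - {0}. ?f x) = 0" by (simp add: algebra_simps)
    moreover have "1 - ?f y \<noteq> 0" using y(2) by (metis right_minus_eq)
    ultimately have "(\<Sum>x\<in>UNIV - {0}. ?f x) = 0" using mult_eq_0_iff by blast
    then show ?thesis unfolding Fp_def by (metis of_int_0 rangeI)
  qed
qed

section \<open>Products of truncated multiple sums\<close>

text \<open>Only the algebraic data: the sums treated here run over finitely many polynomials, so no
  valuation enters yet.\<close>

locale semi_character_sums =
  fixes \<iota> :: "'k::{field, finite} \<Rightarrow> 'l::field"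
    and I :: "nat set"
    and \<delta> :: "nat \<Rightarrow> 'k poly \<Rightarrow> 'l"
    and \<gamma> :: "'k poly \<Rightarrow> 'l"
  assumes embedding: "field_embedding \<iota>"
    and finite_I: "finite I"
    and linear_\<delta>: "\<And>i. i \<in> I \<Longrightarrow> Vector_Spaces.linear smult (\<lambda>c x. \<iota> c * x) (\<delta> i)"
    and linear_\<gamma>: "Vector_Spaces.linear smult (\<lambda>c x. \<iota> c * x) \<gamma>"
    and inj_\<gamma>: "inj \<gamma>"
begin

section \<open>Semi-characters as monomials in the maps \<open>\<delta> i\<close>\<close>

lemma \<gamma>_diff: "\<gamma> (a - b) = \<gamma> a - \<gamma> b"
  and \<gamma>_smult: "\<gamma> (smult c a) = \<iota> c * \<gamma> a"
  and \<gamma>_eq_0_iff: "\<gamma> a = 0 \<longleftrightarrow> a = 0"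
proof -
  interpret g: Vector_Spaces.linear smult "\<lambda>c x. \<iota> c * x" \<gamma> by (rule linear_\<gamma>)
  show "\<gamma> (smult c a) = \<iota> c * \<gamma> a" by (rule g.scale)
  show "\<gamma> (a - b) = \<gamma> a - \<gamma> b" by (rule g.diff)
  show "\<gamma> a = 0 \<longleftrightarrow> a = 0" using inj_\<gamma> g.zero by (metis injD)
qed

lemma \<delta>_add: "i \<in> I \<Longrightarrow> \<delta> i (a + b) = \<delta> i a + \<delta> i b"
  and \<delta>_smult: "i \<in> I \<Longrightarrow> \<delta> i (smult c a) = \<iota> c * \<delta> i a"
  using linear_\<delta>[of i] by (simp_all add: Vector_Spaces.linear_iff)

text \<open>Parametrizes semi-characters by exponent vectors, so that they can be expanded
  binomially. A semi-character need not determine its vector; only the existence of one is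
  used.\<close>

definition monomial :: "(nat \<Rightarrow> nat) \<Rightarrow> 'k poly \<Rightarrow> 'l" where
  "monomial \<alpha> a = (\<Prod>i\<in>I. \<delta> i a ^ \<alpha> i)"

lemma semi_characters_eq: "semi_characters I \<delta> = range monomial"
  by (auto simp: semi_characters_def monomial_def[abs_def])

lemma one_in_semi_characters: "1 \<in> semi_characters I \<delta>"
  unfolding semi_characters_eq
  by (rule image_eqI[of _ _ "\<lambda>_. 0"]) (auto simp: monomial_def[abs_def] fun_eq_iff)

lemma monomial_mult: "monomial \<alpha> * monomial \<beta> = monomial (\<lambda>i. \<alpha> i + \<beta> i)"
  by (auto simp: monomial_def fun_eq_iff power_add prod.distrib)

lemma mult_in_semi_characters:
  "\<sigma> \<in> semi_characters I \<delta> \<Longrightarrow> \<psi> \<in> semi_characters I \<delta> \<Longrightarrow> \<sigma> * \<psi> \<in> semi_characters I \<delta>"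
  by (auto simp: semi_characters_eq monomial_mult)

lemma monomial_smult: "monomial \<alpha> (smult c a) = \<iota> c ^ (\<Sum>i\<in>I. \<alpha> i) * monomial \<alpha> a"
  by (simp add: monomial_def \<delta>_smult power_mult_distrib prod.distrib power_sum)

text \<open>Multiply out one binomial expansion for each \<open>i \<in> I\<close>; an extensional
  function \<open>\<beta>\<close> records the term chosen in each factor.\<close>

lemma monomial_add:
  "monomial \<alpha> (a + c) = (\<Sum>\<beta>\<in>PiE I (\<lambda>i. {..\<alpha> i}).
     of_nat (\<Prod>i\<in>I. \<alpha> i choose \<beta> i) * (monomial \<beta> a * monomial (\<lambda>i. \<alpha> i - \<beta> i) c))"
proof -
  have "monomial \<alpha> (a + c) = (\<Prod>i\<in>I. \<Sum>j\<le>\<alpha> i. of_nat (\<alpha> i choose j) * \<delta> i a ^ j * \<delta> i c ^ (\<alpha> i - j))"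
    by (simp add: monomial_def \<delta>_add binomial_ring)
  also have "\<dots> = (\<Sum>\<beta>\<in>PiE I (\<lambda>i. {..\<alpha> i}). \<Prod>i\<in>I. of_nat (\<alpha> i choose \<beta> i) * \<delta> i a ^ \<beta> i * \<delta> i c ^ (\<alpha> i - \<beta> i))"
    by (rule prod_sum_PiE) (use finite_I in auto)
  finally show ?thesis by (simp add: monomial_def prod.distrib of_nat_prod mult.assoc)
qed

text \<open>This is \<open>S\<^sub>d(\<sigma>; n)\<close>. The degree is the last argument so that
  sequences in the degree can be added and multiplied pointwise.\<close>

definition power_sum_at :: "('k poly \<Rightarrow> 'l) \<Rightarrow> nat \<Rightarrow> nat \<Rightarrow> 'l" where
  "power_sum_at \<sigma> n d = (\<Sum>a\<in>monics d. \<sigma> a / \<gamma> a ^ n)"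

text \<open>A word lists semi-characters with exponents, the letter of largest degree first. Passing
  \<open>e\<close> down as the new strict bound enforces strictly decreasing degrees.\<close>

fun partial_sum :: "(('k poly \<Rightarrow> 'l) \<times> nat) list \<Rightarrow> nat \<Rightarrow> 'l" where
  "partial_sum [] = 1"
| "partial_sum ((\<sigma>, n) # w) = (\<lambda>d. \<Sum>e<d. power_sum_at \<sigma> n e * partial_sum w e)"

text \<open>Write \<open>c\<close> as a unit times a monic polynomial: numerator and denominator are
  homogeneous in the unit, so the sum factors.\<close>

lemma sum_nonzero_degree_less:
  "(\<Sum>c | c \<noteq> 0 \<and> degree c < d. monomial \<alpha> c / \<gamma> c ^ k) =
   (\<Sum>x\<in>UNIV - {0}. \<iota> x ^ (\<Sum>i\<in>I. \<alpha> i) / \<iota> x ^ k) * partial_sum [(monomial \<alpha>, k)] d"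
proof -
  let ?M = "\<Union>e<d. monics e :: 'k poly set"
  have "(\<Sum>c | c \<noteq> 0 \<and> degree c < d. monomial \<alpha> c / \<gamma> c ^ k) =
      (\<Sum>(x, c)\<in>(UNIV - {0}) \<times> ?M. monomial \<alpha> (smult x c) / \<gamma> (smult x c) ^ k)"
    by (simp add: sum.reindex_bij_betw[OF bij_betw_smult_monics, symmetric] case_prod_beta)
  also have "\<dots> = (\<Sum>(x, c)\<in>(UNIV - {0}) \<times> ?M.
      (\<iota> x ^ (\<Sum>i\<in>I. \<alpha> i) / \<iota> x ^ k) * (monomial \<alpha> c / \<gamma> c ^ k))"
    by (simp add: monomial_smult \<gamma>_smult power_mult_distrib)
  also have "\<dots> = (\<Sum>x\<in>UNIV - {0}. \<iota> x ^ (\<Sum>i\<in>I. \<alpha> i) / \<iota> x ^ k) * (\<Sum>c\<in>?M. monomial \<alpha> c / \<gamma> c ^ k)"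
    by (simp add: sum_product sum.cartesian_product)
  also have "(\<Sum>c\<in>?M. monomial \<alpha> c / \<gamma> c ^ k) = partial_sum [(monomial \<alpha>, k)] d"
    by (simp add: power_sum_at_def, rule sum.UNION_disjoint) (auto, auto simp: monics_def)
  finally show ?thesis .
qed

text \<open>Generators of the correction terms in a product of two power sums. Summing such a
  generator over degrees below \<open>d\<close> gives a truncated sum of depth two.\<close>

definition products_of_two_sums :: "nat \<Rightarrow> ('k poly \<Rightarrow> 'l) \<Rightarrow> (nat \<Rightarrow> 'l) set" where
  "products_of_two_sums N \<phi> = {power_sum_at \<sigma> i * partial_sum [(\<psi>, j)] | \<sigma> \<psi> i j.
     \<sigma> \<in> semi_characters I \<delta> \<and> \<psi> \<in> semi_characters I \<delta> \<and> \<sigma> * \<psi> = \<phi> \<and> i + j = N \<and> i > 0 \<and> j > 0}"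

section \<open>Off-diagonal pairs and partial fractions\<close>

text \<open>The exponent \<open>k\<close> records the powers of \<open>\<gamma> (b - a)\<close> produced by the partial fraction steps;
  only \<open>k = 0\<close> occurs in the product formula.\<close>

definition off_diagonal_sum ::
    "('k poly \<Rightarrow> 'l) \<Rightarrow> ('k poly \<Rightarrow> 'l) \<Rightarrow> nat \<Rightarrow> nat \<Rightarrow> nat \<Rightarrow> nat \<Rightarrow> 'l" where
  "off_diagonal_sum \<sigma> \<psi> m n k d =
     (\<Sum>(a, b) | a \<in> monics d \<and> b \<in> monics d \<and> a \<noteq> b.
        \<sigma> a * \<psi> b / (\<gamma> a ^ m * \<gamma> b ^ n * \<gamma> (b - a) ^ k))"

text \<open>Exchange the names of \<open>a\<close> and \<open>b\<close>; the sign comes from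
  \<open>\<gamma> (b - a) = - \<gamma> (a - b)\<close>.\<close>

lemma off_diagonal_sum_swap:
  "off_diagonal_sum \<sigma> \<psi> m n k = (\<lambda>d. (- 1) ^ k * off_diagonal_sum \<psi> \<sigma> n m k d)"
proof
  fix d
  have *: "\<gamma> (b - a) ^ k = (- 1) ^ k * \<gamma> (a - b) ^ k" for a b
    by (simp add: \<gamma>_diff flip: power_mult_distrib)
  have "off_diagonal_sum \<sigma> \<psi> m n k d =
      (\<Sum>(b, a) | b \<in> monics d \<and> a \<in> monics d \<and> b \<noteq> a.
        \<sigma> a * \<psi> b / (\<gamma> a ^ m * \<gamma> b ^ n * \<gamma> (b - a) ^ k))"
    unfolding off_diagonal_sum_def
    by (rule sum.reindex_bij_witness[of _ "\<lambda>(a, b). (b, a)" "\<lambda>(a, b). (b, a)"]) auto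
  also have "\<dots> = (- 1) ^ k * off_diagonal_sum \<psi> \<sigma> n m k d"
    unfolding off_diagonal_sum_def sum_distrib_left
  proof (rule sum.cong[OF refl], clarify)
    fix b a
    show "\<sigma> a * \<psi> b / (\<gamma> a ^ m * \<gamma> b ^ n * \<gamma> (b - a) ^ k) =
        (- 1) ^ k * (\<psi> b * \<sigma> a / (\<gamma> b ^ n * \<gamma> a ^ m * \<gamma> (a - b) ^ k))"
      unfolding *[of b a] by (simp add: mult_ac minus_one_power_iff)
  qed
  finally show "off_diagonal_sum \<sigma> \<psi> m n k d = \<dots>" .
qed

text \<open>With no power of \<open>\<gamma> b\<close> left, putting \<open>b = a + c\<close> makes
  the denominator a product of a function of \<open>a\<close> and one of \<open>c\<close>. Expanding
  \<open>\<psi> (a + c)\<close> separates the numerator too, and every term becomes a product of two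
  sums.\<close>

lemma off_diagonal_sum_zero:
  assumes \<sigma>: "\<sigma> \<in> semi_characters I \<delta>" and \<psi>: "\<psi> \<in> semi_characters I \<delta>" and "m > 0" "k > 0"
  shows "off_diagonal_sum \<sigma> \<psi> m 0 k \<in> group_closure (products_of_two_sums (m + k) (\<sigma> * \<psi>))"
proof -
  obtain \<alpha> where \<alpha>: "\<psi> = monomial \<alpha>" using \<psi> by (auto simp: semi_characters_eq)
  let ?B = "PiE I (\<lambda>i. {..\<alpha> i})"
  let ?\<beta>' = "\<lambda>\<beta> i. \<alpha> i - \<beta> i"
  let ?N = "\<lambda>\<beta>. of_nat (\<Prod>i\<in>I. \<alpha> i choose \<beta> i) :: 'l"
  let ?S = "\<lambda>\<beta>. \<Sum>x\<in>UNIV - {0}. \<iota> x ^ (\<Sum>i\<in>I. ?\<beta>' \<beta> i) / \<iota> x ^ k"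
  let ?f = "\<lambda>\<beta>. power_sum_at (\<sigma> * monomial \<beta>) m * partial_sum [(monomial (?\<beta>' \<beta>), k)]"
  \<comment> \<open>The coefficients \<open>?N \<beta>\<close> and \<open>?S \<beta>\<close> do not
    depend on \<open>d\<close>, so this is one combination of sequences.\<close>
  have "off_diagonal_sum \<sigma> \<psi> m 0 k = (\<Sum>\<beta>\<in>?B. (\<lambda>d. ?N \<beta> * (?S \<beta> * ?f \<beta> d)))"
  proof
    fix d
    have "off_diagonal_sum \<sigma> \<psi> m 0 k d =
        (\<Sum>(a, c)\<in>monics d \<times> {c. c \<noteq> 0 \<and> degree c < d}. \<sigma> a * \<psi> (a + c) / (\<gamma> a ^ m * \<gamma> c ^ k))"
      by (simp add: off_diagonal_sum_def case_prod_beta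
          sum.reindex_bij_betw[OF bij_betw_monic_pairs, symmetric])
    also have "\<dots> = (\<Sum>(a, c)\<in>monics d \<times> {c. c \<noteq> 0 \<and> degree c < d}. \<Sum>\<beta>\<in>?B.
        ?N \<beta> * ((\<sigma> a * monomial \<beta> a / \<gamma> a ^ m) * (monomial (?\<beta>' \<beta>) c / \<gamma> c ^ k)))"
      by (simp add: \<alpha> monomial_add sum_distrib_left sum_divide_distrib mult_ac)
    also have "\<dots> = (\<Sum>\<beta>\<in>?B. ?N \<beta> * (\<Sum>(a, c)\<in>monics d \<times> {c. c \<noteq> 0 \<and> degree c < d}. 
        (\<sigma> a * monomial \<beta> a / \<gamma> a ^ m) * (monomial (?\<beta>' \<beta>) c / \<gamma> c ^ k)))"
      by (simp add: case_prod_beta sum_distrib_left, rule sum.swap)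
    also have "\<dots> = (\<Sum>\<beta>\<in>?B. ?N \<beta> * (power_sum_at (\<sigma> * monomial \<beta>) m d *
        (\<Sum>c | c \<noteq> 0 \<and> degree c < d. monomial (?\<beta>' \<beta>) c / \<gamma> c ^ k)))"
      by (simp add: power_sum_at_def sum_product sum.cartesian_product)
    also have "\<dots> = (\<Sum>\<beta>\<in>?B. ?N \<beta> * (?S \<beta> * ?f \<beta> d))"
      by (simp only: sum_nonzero_degree_less times_fun_apply mult.left_commute mult.assoc)
    also have "\<dots> = (\<Sum>\<beta>\<in>?B. (\<lambda>d. ?N \<beta> * (?S \<beta> * ?f \<beta> d))) d"
      by (simp only: sum_fun_apply)
    finally show "off_diagonal_sum \<sigma> \<psi> m 0 k d = (\<Sum>\<beta>\<in>?B. (\<lambda>d. ?N \<beta> * (?S \<beta> * ?f \<beta> d))) d" .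
  qed
  also have "\<dots> \<in> group_closure (products_of_two_sums (m + k) (\<sigma> * \<psi>))"
  proof (intro group_closure_sum group_closure_Fp_mult group_closure_superset)
    fix \<beta> assume \<beta>: "\<beta> \<in> ?B"
    \<comment> \<open>On \<open>I\<close> one has \<open>\<beta> i \<le> \<alpha> i\<close>, so the
      truncated subtraction in \<open>?\<beta>'\<close> is exact.\<close>
    then have "monomial \<beta> * monomial (?\<beta>' \<beta>) = \<psi>"
      unfolding \<alpha> monomial_mult by (auto simp: monomial_def fun_eq_iff PiE_iff intro!: prod.cong)
    moreover have "\<sigma> * monomial \<beta> \<in> semi_characters I \<delta>"
      by (rule mult_in_semi_characters[OF \<sigma>]) (auto simp: semi_characters_eq)
    moreover have "monomial (?\<beta>' \<beta>) \<in> semi_characters I \<delta>" by (auto simp: semi_characters_eq)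
    ultimately show "?f \<beta> \<in> products_of_two_sums (m + k) (\<sigma> * \<psi>)"
      using \<open>m > 0\<close> \<open>k > 0\<close> unfolding products_of_two_sums_def by (blast intro: mult.assoc)
    show "?N \<beta> \<in> Fp" unfolding Fp_def by (metis of_int_of_nat_eq rangeI)
    show "?S \<beta> \<in> Fp" by (rule sum_units_power_ratio_in_Fp[OF embedding])
  qed
  finally show ?thesis .
qed

text \<open>With \<open>Z = Y - X\<close>, this is \<open>1 / (X * Y) = 1 / (X * Z) - 1 / (Y * Z)\<close>.\<close>

lemma off_diagonal_sum_step:
  "off_diagonal_sum \<sigma> \<psi> (Suc m) (Suc n) k =
     off_diagonal_sum \<sigma> \<psi> (Suc m) n (Suc k) - off_diagonal_sum \<sigma> \<psi> m (Suc n) (Suc k)"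
proof
  fix d
  show "off_diagonal_sum \<sigma> \<psi> (Suc m) (Suc n) k d =
     (off_diagonal_sum \<sigma> \<psi> (Suc m) n (Suc k) - off_diagonal_sum \<sigma> \<psi> m (Suc n) (Suc k)) d"
    unfolding off_diagonal_sum_def minus_apply sum_subtractf[symmetric]
  proof (rule sum.cong[OF refl], clarify)
    fix a b :: "'k poly"
    assume "a \<in> monics d" "b \<in> monics d" "a \<noteq> b"
    then have nz: "\<gamma> a \<noteq> 0" "\<gamma> b \<noteq> 0" "\<gamma> b - \<gamma> a \<noteq> 0"
      by (auto simp: \<gamma>_eq_0_iff simp flip: \<gamma>_diff dest: monics_nonzero)
    have *: "x / (X ^ Suc m * Y ^ Suc n * Z ^ k) =
        x / (X ^ Suc m * Y ^ n * Z ^ Suc k) - x / (X ^ m * Y ^ Suc n * Z ^ Suc k)"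
      if "Z = Y - X" "X \<noteq> 0" "Y \<noteq> 0" "Z \<noteq> 0" for x X Y Z :: 'l
    proof -
      have "x / (X ^ Suc m * Y ^ n * Z ^ Suc k) - x / (X ^ m * Y ^ Suc n * Z ^ Suc k)
          = x * (Y - X) / (X ^ Suc m * Y ^ Suc n * Z ^ Suc k)"
        using that(2-) by (simp add: field_simps)
      then show ?thesis using that by simp
    qed
    show "\<sigma> a * \<psi> b / (\<gamma> a ^ Suc m * \<gamma> b ^ Suc n * \<gamma> (b - a) ^ k) =
      \<sigma> a * \<psi> b / (\<gamma> a ^ Suc m * \<gamma> b ^ n * \<gamma> (b - a) ^ Suc k) -
      \<sigma> a * \<psi> b / (\<gamma> a ^ m * \<gamma> b ^ Suc n * \<gamma> (b - a) ^ Suc k)"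
      unfolding \<gamma>_diff by (rule *[OF refl nz])
  qed
qed

text \<open>Each partial fraction step lowers \<open>m + n\<close> by one and raises
  \<open>k\<close> by one, keeping the weight. It ends when \<open>m\<close> or \<open>n\<close> is
  0; the side conditions ensure that then \<open>k\<close> and the other exponent are
  positive.\<close>

lemma off_diagonal_sum_in_closure:
  assumes \<sigma>: "\<sigma> \<in> semi_characters I \<delta>" and \<psi>: "\<psi> \<in> semi_characters I \<delta>"
    and "m + n > 0" and "k > 0 \<or> m > 0 \<and> n > 0"
  shows "off_diagonal_sum \<sigma> \<psi> m n k \<in> group_closure (products_of_two_sums (m + n + k) (\<sigma> * \<psi>))"
  using assms(3,4)
proof (induction "m + n" arbitrary: m n k rule: less_induct)
  case less
  consider "n = 0" | "m = 0" "n > 0" | m' n' where "m = Suc m'" "n = Suc n'"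
    by (metis neq0_conv not0_implies_Suc)
  then show ?case
  proof cases
    case 1
    then show ?thesis using off_diagonal_sum_zero[OF \<sigma> \<psi>, of m k] less.prems by simp
  next
    case 2
    have "(- 1) ^ k \<in> (Fp :: 'l set)" unfolding Fp_def by (rule range_eqI[of _ _ "(- 1) ^ k"]) simp
    then show ?thesis
      using off_diagonal_sum_zero[OF \<psi> \<sigma>, of n k] 2 less.prems
      by (subst off_diagonal_sum_swap) (auto intro!: group_closure_Fp_mult simp: mult.commute)
  next
    case 3
    then show ?thesis
      using less.hyps[of m n' "Suc k"] less.hyps[of m' n "Suc k"]
      by (auto simp: off_diagonal_sum_step intro: group_closure.diff)
  qed
qed

lemma power_sum_at_mult:
  assumes "\<sigma> \<in> semi_characters I \<delta>" and "\<psi> \<in> semi_characters I \<delta>" and "m > 0" and "n > 0"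
  shows "\<exists>r \<in> group_closure (products_of_two_sums (m + n) (\<sigma> * \<psi>)).
     power_sum_at \<sigma> m * power_sum_at \<psi> n = power_sum_at (\<sigma> * \<psi>) (m + n) + r"
proof (rule bexI)
  show "off_diagonal_sum \<sigma> \<psi> m n 0 \<in> group_closure (products_of_two_sums (m + n) (\<sigma> * \<psi>))"
    using off_diagonal_sum_in_closure[OF assms(1,2), of m n 0] assms(3,4) by simp
  show "power_sum_at \<sigma> m * power_sum_at \<psi> n =
      power_sum_at (\<sigma> * \<psi>) (m + n) + off_diagonal_sum \<sigma> \<psi> m n 0"
  proof
    fix d
    let ?f = "\<lambda>(a, b). \<sigma> a * \<psi> b / (\<gamma> a ^ m * \<gamma> b ^ n)"
    let ?O = "{(a, b). a \<in> monics d \<and> b \<in> monics d \<and> a \<noteq> (b :: 'k poly)}"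
    let ?D = "(\<lambda>a. (a, a)) ` (monics d :: 'k poly set)"
    have "(power_sum_at \<sigma> m * power_sum_at \<psi> n) d = sum ?f (monics d \<times> monics d)"
      by (simp add: power_sum_at_def sum_product sum.cartesian_product)
    also have "monics d \<times> monics d = ?D \<union> ?O" by auto
    also have "sum ?f (?D \<union> ?O) = sum ?f ?D + sum ?f ?O"
    proof (rule sum.union_disjoint)
      show "finite ?O" by (rule finite_subset[of _ "monics d \<times> monics d"]) auto
    qed auto
    also have "sum ?f ?D = power_sum_at (\<sigma> * \<psi>) (m + n) d"
      by (subst sum.reindex) (auto simp: inj_on_def power_sum_at_def power_add)
    finally show "(power_sum_at \<sigma> m * power_sum_at \<psi> n) d =
      (power_sum_at (\<sigma> * \<psi>) (m + n) + off_diagonal_sum \<sigma> \<psi> m n 0) d"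
      by (simp add: off_diagonal_sum_def)
  qed
qed

section \<open>Products of words, by induction on the depth\<close>

text \<open>The depth is only bounded by \<open>k\<close>, because products of multiple sums mix different depths.\<close>

definition words :: "nat \<Rightarrow> nat \<Rightarrow> ('k poly \<Rightarrow> 'l) \<Rightarrow> (('k poly \<Rightarrow> 'l) \<times> nat) list set" where
  "words k N \<phi> = {w. length w \<le> k \<and> (\<forall>(\<sigma>, n)\<in>set w. \<sigma> \<in> semi_characters I \<delta> \<and> n > 0) \<and>
     sum_list (map snd w) = N \<and> prod_list (map fst w) = \<phi>}"

text \<open>The closure is taken among sequences in the truncation degree, so membership provides
  one integer combination valid for all degrees, which survives passage to the limit.\<close>

abbreviation partial_sum_space :: "nat \<Rightarrow> nat \<Rightarrow> ('k poly \<Rightarrow> 'l) \<Rightarrow> (nat \<Rightarrow> 'l) set" where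
  "partial_sum_space k N \<phi> \<equiv> group_closure (partial_sum ` words k N \<phi>)"

lemma partial_sum_space_mono:
  assumes "f \<in> partial_sum_space k N \<phi>" "k \<le> k'"
  shows "f \<in> partial_sum_space k' N \<phi>"
  by (rule group_closure_mono[OF _ assms(1)]) (use assms(2) in \<open>auto simp: words_def\<close>)

text \<open>Prefixing a letter is an additive operator on sequences and sends the truncated sum of
  \<open>w\<close> to that of the longer word. \<open>N'\<close> and \<open>\<phi>'\<close> are
  separate variables so that they can be matched up to commutativity.\<close>

lemma partial_sum_space_Cons:
  assumes f: "f \<in> partial_sum_space k N \<phi>" and \<sigma>: "\<sigma> \<in> semi_characters I \<delta>" and n: "n > 0"
    and "N' = n + N" "\<phi>' = \<sigma> * \<phi>"
  shows "(\<lambda>d. \<Sum>e<d. power_sum_at \<sigma> n e * f e) \<in> partial_sum_space (Suc k) N' \<phi>'"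
proof (rule group_closure_hom[OF f])
  fix s assume "s \<in> partial_sum ` words k N \<phi>"
  then obtain w where w: "w \<in> words k N \<phi>" and s: "s = partial_sum w" by auto
  have "(\<sigma>, n) # w \<in> words (Suc k) N' \<phi>'"
    using w assms by (auto simp: words_def)
  then show "(\<lambda>d. \<Sum>e<d. power_sum_at \<sigma> n e * s e) \<in> partial_sum_space (Suc k) N' \<phi>'"
    by (intro group_closure_superset) (auto simp: s intro!: rev_image_eqI)
qed (auto simp: fun_eq_iff algebra_simps sum_subtractf)

text \<open>Split the product by the larger of the two leading degrees. If they differ, a letter is
  removed from one factor only; if they agree, \<open>power_sum_at_mult\<close> merges the two
  leading letters up to a correction \<open>r\<close>. In all cases the remaining product has a
  smaller total depth bound.\<close>

lemma partial_sum_mult: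
  assumes "u \<in> words k M \<phi>" and "v \<in> words l N \<psi>"
  shows "partial_sum u * partial_sum v \<in> partial_sum_space (k + l) (M + N) (\<phi> * \<psi>)"
  using assms
proof (induction "k + l" arbitrary: k l u v M N \<phi> \<psi> rule: less_induct)
  case less
  have base: "partial_sum w \<in> partial_sum_space k N \<phi>" if "w \<in> words k N \<phi>" for w k N \<phi>
    using that by (auto intro: group_closure_superset)
  consider "u = []" | "v = []" | \<sigma> m u' \<tau> n v' where "u = (\<sigma>, m) # u'" "v = (\<tau>, n) # v'"
    by (metis neq_Nil_conv surj_pair)
  then show ?case
  proof cases
    case 1
    then have "M = 0" "\<phi> = 1" using less.prems by (auto simp: words_def)
    then show ?thesis using 1 partial_sum_space_mono[OF base[OF less.prems(2)], of "k + l"] by simp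
  next
    case 2
    then have "N = 0" "\<psi> = 1" using less.prems by (auto simp: words_def)
    then show ?thesis using 2 partial_sum_space_mono[OF base[OF less.prems(1)], of "k + l"] by simp
  next
    case 3
    define M' N' \<phi>' \<psi>' where "M' = sum_list (map snd u')" and "N' = sum_list (map snd v')"
      and "\<phi>' = prod_list (map fst u')" and "\<psi>' = prod_list (map fst v')"
    obtain k' l' where k': "k = Suc k'" and l': "l = Suc l'"
      using 3 less.prems by (cases k; cases l) (auto simp: words_def)
    have u': "u' \<in> words k' M' \<phi>'" and v': "v' \<in> words l' N' \<psi>'"
      and \<sigma>: "\<sigma> \<in> semi_characters I \<delta>" "m > 0" and \<tau>: "\<tau> \<in> semi_characters I \<delta>" "n > 0"
      and M: "M = m + M'" "\<phi> = \<sigma> * \<phi>'" and N: "N = n + N'" "\<psi> = \<tau> * \<psi>'"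
      using 3 less.prems k' l' by (auto simp: words_def M'_def N'_def \<phi>'_def \<psi>'_def)
    let ?G = "partial_sum_space (k + l) (M + N) (\<phi> * \<psi>)"
    define h where "h = partial_sum u' * partial_sum v'"
    have h: "h \<in> partial_sum_space (k' + l') (M' + N') (\<phi>' * \<psi>')"
      unfolding h_def by (rule less.hyps) (use u' v' k' l' in auto)
    obtain r where r: "r \<in> group_closure (products_of_two_sums (m + n) (\<sigma> * \<tau>))"
      and st: "power_sum_at \<sigma> m * power_sum_at \<tau> n = power_sum_at (\<sigma> * \<tau>) (m + n) + r"
      using power_sum_at_mult[OF \<sigma>(1) \<tau>(1) \<sigma>(2) \<tau>(2)] by auto
    \<comment> \<open>The leading degree of \<open>u\<close> is the larger: \<open>v\<close> stays
      whole, and the bound for the remaining product is \<open>k' + l\<close>.\<close>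
    have "(\<lambda>d. \<Sum>e<d. power_sum_at \<sigma> m e * (partial_sum u' * partial_sum v) e) \<in>
        partial_sum_space (Suc (k' + l)) (M + N) (\<phi> * \<psi>)"
      by (rule partial_sum_space_Cons[OF less.hyps])
        (use k' u' less.prems \<sigma> M in \<open>auto simp: mult_ac\<close>)
    then have 1: "(\<lambda>d. \<Sum>e<d. power_sum_at \<sigma> m e * (partial_sum u' * partial_sum v) e) \<in> ?G"
      using k' by simp
    have "(\<lambda>d. \<Sum>e<d. power_sum_at \<tau> n e * (partial_sum u * partial_sum v') e) \<in>
        partial_sum_space (Suc (k + l')) (M + N) (\<phi> * \<psi>)"
      by (rule partial_sum_space_Cons[OF less.hyps])
        (use l' v' less.prems \<tau> N in \<open>auto simp: mult_ac\<close>)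
    then have 2: "(\<lambda>d. \<Sum>e<d. power_sum_at \<tau> n e * (partial_sum u * partial_sum v') e) \<in> ?G"
      using l' by simp
    have "(\<lambda>d. \<Sum>e<d. power_sum_at (\<sigma> * \<tau>) (m + n) e * h e) \<in>
        partial_sum_space (Suc (k' + l')) (M + N) (\<phi> * \<psi>)"
      by (rule partial_sum_space_Cons[OF h])
        (use \<sigma> \<tau> M N in \<open>auto simp: mult_ac intro: mult_in_semi_characters\<close>)
    then have 3: "(\<lambda>d. \<Sum>e<d. power_sum_at (\<sigma> * \<tau>) (m + n) e * h e) \<in> ?G"
      by (rule partial_sum_space_mono) (use k' l' in auto)
    \<comment> \<open>A correction term keeps \<open>\<alpha>\<close> at degree \<open>e\<close> and
      adds a letter \<open>\<beta>\<close> of lower degree, which must still be multiplied with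
      \<open>h\<close>.\<close>
    have 4: "(\<lambda>d. \<Sum>e<d. r e * h e) \<in> ?G"
    proof (rule group_closure_hom[OF r])
      fix s assume "s \<in> products_of_two_sums (m + n) (\<sigma> * \<tau>)"
      then obtain \<alpha> \<beta> i j where s: "s = power_sum_at \<alpha> i * partial_sum [(\<beta>, j)]"
        and \<alpha>: "\<alpha> \<in> semi_characters I \<delta>" "i > 0" and \<beta>: "\<beta> \<in> semi_characters I \<delta>" "j > 0"
        and eq: "\<alpha> * \<beta> = \<sigma> * \<tau>" "i + j = m + n"
        by (auto simp: products_of_two_sums_def)
      have "partial_sum [(\<beta>, j)] * h \<in> partial_sum_space (Suc (k' + l')) (j + (M' + N')) (\<beta> * (\<phi>' * \<psi>'))"
      proof (rule group_closure_mult[OF _ h])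
        show "partial_sum [(\<beta>, j)] \<in> group_closure {partial_sum [(\<beta>, j)]}"
          by (simp add: group_closure_superset)
        fix t t' assume t: "t \<in> {partial_sum [(\<beta>, j)]}"
          and "t' \<in> partial_sum ` words (k' + l') (M' + N') (\<phi>' * \<psi>')"
        then obtain w where w: "w \<in> words (k' + l') (M' + N') (\<phi>' * \<psi>')" and t': "t' = partial_sum w"
          by auto
        \<comment> \<open>The bound \<open>1 + (k' + l')\<close> equals \<open>k + l - 1\<close>, so
          the induction hypothesis applies even to the new letter times a generator of the space
          containing \<open>h\<close>.\<close>
        have "partial_sum [(\<beta>, j)] * partial_sum w \<in>
            partial_sum_space (1 + (k' + l')) (j + (M' + N')) (\<beta> * (\<phi>' * \<psi>'))"
          by (rule less.hyps) (use k' l' \<beta> w in \<open>auto simp: words_def\<close>)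
        with t t' show "t * t' \<in> partial_sum_space (Suc (k' + l')) (j + (M' + N')) (\<beta> * (\<phi>' * \<psi>'))"
          by simp
      qed
      then have "(\<lambda>d. \<Sum>e<d. power_sum_at \<alpha> i e * (partial_sum [(\<beta>, j)] * h) e) \<in>
          partial_sum_space (Suc (Suc (k' + l'))) (M + N) (\<phi> * \<psi>)"
      proof (rule partial_sum_space_Cons)
        show "M + N = i + (j + (M' + N'))" using eq M N by simp
        have "\<phi> * \<psi> = (\<sigma> * \<tau>) * (\<phi>' * \<psi>')" using M N by (simp only: mult_ac)
        then show "\<phi> * \<psi> = \<alpha> * (\<beta> * (\<phi>' * \<psi>'))" by (simp only: eq(1)[symmetric] mult.assoc)
      qed (use \<alpha> in auto)
      moreover have "Suc (Suc (k' + l')) = k + l" using k' l' by simp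
      ultimately show "(\<lambda>d. \<Sum>e<d. s e * h e) \<in> ?G" by (simp add: s mult.assoc)
    qed (auto simp: fun_eq_iff algebra_simps sum_subtractf)
    have st': "power_sum_at \<sigma> m e * power_sum_at \<tau> n e = power_sum_at (\<sigma> * \<tau>) (m + n) e + r e" for e
      using fun_cong[OF st, of e] by simp
    have "partial_sum u * partial_sum v =
      (\<lambda>d. \<Sum>e<d. power_sum_at \<sigma> m e * (partial_sum u' * partial_sum v) e) +
      (\<lambda>d. \<Sum>e<d. power_sum_at \<tau> n e * (partial_sum u * partial_sum v') e) +
      ((\<lambda>d. \<Sum>e<d. power_sum_at (\<sigma> * \<tau>) (m + n) e * h e) + (\<lambda>d. \<Sum>e<d. r e * h e))"
      (is "_ = ?R")
    proof
      fix d
      have "(partial_sum u * partial_sum v) d = (\<Sum>e<d.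
         power_sum_at \<sigma> m e * partial_sum u' e * partial_sum v e +
         power_sum_at \<tau> n e * partial_sum v' e * partial_sum u e +
         (power_sum_at \<sigma> m e * power_sum_at \<tau> n e) * h e)"
        by (simp add: \<open>u = _\<close> \<open>v = _\<close> sum_lessThan_mult_sum_lessThan h_def mult_ac)
      also have "\<dots> = ?R d"
        unfolding st' by (simp add: sum.distrib algebra_simps)
      finally show "(partial_sum u * partial_sum v) d = ?R d" .
    qed
    also have "\<dots> \<in> ?G" by (intro group_closure_add 1 2 3 4)
    finally show ?thesis .
  qed
qed

end

section \<open>The ultrametric absolute value\<close>

text \<open>The multiplicative ultrametric absolute value attached to \<open>\<nu>\<close>; it turns
  convergence for \<open>\<nu>\<close> into convergence of real numbers.\<close>

definition val_abs :: "('l::field \<Rightarrow> rat extended) \<Rightarrow> 'l \<Rightarrow> real" where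
  "val_abs \<nu> x = val_dist \<nu> x 0"

context
  fixes \<nu> :: "'l::field \<Rightarrow> rat extended"
  assumes val: "valuation \<nu>"
begin

interpretation val: Metric_space UNIV "val_dist \<nu>"
  by (rule Metric_space_val_dist[OF val])

lemma val_dist_eq: "val_dist \<nu> x y = val_abs \<nu> (x - y)"
  by (simp add: val_dist_def val_abs_def)

lemma val_abs_nonneg: "0 \<le> val_abs \<nu> x"
  by (simp add: val_abs_def)

lemma val_abs_zero: "val_abs \<nu> 0 = 0"
  by (simp add: val_abs_def)

lemma val_abs_mult: "val_abs \<nu> (x * y) = val_abs \<nu> x * val_abs \<nu> y"
proof -
  have "\<nu> (x * y) = \<nu> x + \<nu> y" "\<nu> x \<noteq> Minf" "\<nu> y \<noteq> Minf"
    using val by (auto simp: valuation_def)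
  then show ?thesis
    by (cases "\<nu> x"; cases "\<nu> y") (auto simp: val_abs_def val_dist_def of_rat_add simp flip: powr_add)
qed

lemma val_abs_minus: "val_abs \<nu> (- x) = val_abs \<nu> x"
  using val.commute[of 0 x] by (simp add: val_dist_eq)

lemma val_abs_add: "val_abs \<nu> (x + y) \<le> max (val_abs \<nu> x) (val_abs \<nu> y)"
proof -
  have "min (\<nu> x) (\<nu> y) \<le> \<nu> (x + y)" "\<nu> x \<noteq> Minf" "\<nu> y \<noteq> Minf" "\<nu> (x + y) \<noteq> Minf"
    using val by (auto simp: valuation_def)
  then show ?thesis
    by (auto simp: val_abs_def val_dist_def min_def max_def of_rat_less_eq
        split: extended.splits if_splits)
qed

lemma val_abs_add_le: "val_abs \<nu> (x + y) \<le> val_abs \<nu> x + val_abs \<nu> y"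
  using val_abs_add[of x y] val_abs_nonneg[of x] val_abs_nonneg[of y] by linarith

lemma val_abs_one: "val_abs \<nu> 1 = 1"
proof -
  have "val_abs \<nu> 1 \<noteq> 0" using val.mdist_zero val.zero[of 1 0] by (simp add: val_abs_def)
  then show ?thesis using val_abs_mult[of 1 1] by simp
qed

lemma val_abs_power: "val_abs \<nu> (x ^ n) = val_abs \<nu> x ^ n"
  by (induction n) (auto simp: val_abs_one val_abs_mult)

lemma val_abs_prod: "val_abs \<nu> (prod f J) = (\<Prod>i\<in>J. val_abs \<nu> (f i))"
  by (induction J rule: infinite_finite_induct) (auto simp: val_abs_one val_abs_mult)

text \<open>By the ultrametric inequality the bound does not grow with the number of terms.
  Positivity of \<open>\<epsilon>\<close> handles the empty sum.\<close>

lemma val_abs_sum_less: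
  assumes "\<epsilon> > 0" and "\<And>i. i \<in> J \<Longrightarrow> val_abs \<nu> (f i) < \<epsilon>"
  shows "val_abs \<nu> (sum f J) < \<epsilon>"
  using assms(2)
proof (induction J rule: infinite_finite_induct)
  case (insert j J)
  then have "max (val_abs \<nu> (f j)) (val_abs \<nu> (sum f J)) < \<epsilon>" by simp
  with val_abs_add have "val_abs \<nu> (f j + sum f J) < \<epsilon>" by (rule le_less_trans)
  with insert.hyps show ?case by simp
qed (use assms(1) in \<open>auto simp: val_abs_zero\<close>)

lemma limitin_val_topology_iff:
  "limitin (val_topology \<nu>) f l F \<longleftrightarrow> ((\<lambda>x. val_abs \<nu> (f x - l)) \<longlongrightarrow> 0) F"
  by (simp add: val.limitin_metric_dist_null val_dist_eq)

lemma limitin_val_topology_diff: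
  assumes "limitin (val_topology \<nu>) f l F" and "limitin (val_topology \<nu>) g m F"
  shows "limitin (val_topology \<nu>) (f - g) (l - m) F"
  unfolding limitin_val_topology_iff
proof (rule Lim_null_comparison)
  have "norm (val_abs \<nu> ((f - g) x - (l - m))) \<le> val_abs \<nu> (f x - l) + val_abs \<nu> (g x - m)" for x
    using val_abs_add_le[of "f x - l" "- (g x - m)"] val_abs_minus[of "g x - m"] val_abs_nonneg
    by (simp add: algebra_simps)
  then show "\<forall>\<^sub>F x in F. norm (val_abs \<nu> ((f - g) x - (l - m))) \<le> val_abs \<nu> (f x - l) + val_abs \<nu> (g x - m)"
    by simp
  show "((\<lambda>x. val_abs \<nu> (f x - l) + val_abs \<nu> (g x - m)) \<longlongrightarrow> 0) F"
    using tendsto_add[OF assms[unfolded limitin_val_topology_iff]] by simp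
qed

lemma limitin_val_topology_mult:
  assumes "limitin (val_topology \<nu>) f l F" and "limitin (val_topology \<nu>) g m F"
  shows "limitin (val_topology \<nu>) (f * g) (l * m) F"
  unfolding limitin_val_topology_iff
proof (rule Lim_null_comparison)
  let ?a = "\<lambda>x. val_abs \<nu> (f x - l)" and ?b = "\<lambda>x. val_abs \<nu> (g x - m)"
  have "norm (val_abs \<nu> ((f * g) x - l * m)) \<le> ?a x * ?b x + val_abs \<nu> l * ?b x + ?a x * val_abs \<nu> m" for x
  proof -
    have "(f * g) x - l * m = (f x - l) * (g x - m) + l * (g x - m) + (f x - l) * m"
      by (simp add: algebra_simps)
    then have "val_abs \<nu> ((f * g) x - l * m) \<le>
        val_abs \<nu> ((f x - l) * (g x - m)) + val_abs \<nu> (l * (g x - m)) + val_abs \<nu> ((f x - l) * m)"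
      using val_abs_add_le[of "(f x - l) * (g x - m) + l * (g x - m)" "(f x - l) * m"]
        val_abs_add_le[of "(f x - l) * (g x - m)" "l * (g x - m)"] by simp
    then show ?thesis using val_abs_nonneg by (simp add: val_abs_mult)
  qed
  then show "\<forall>\<^sub>F x in F. norm (val_abs \<nu> ((f * g) x - l * m)) \<le> ?a x * ?b x + val_abs \<nu> l * ?b x + ?a x * val_abs \<nu> m"
    by simp
  have "((\<lambda>x. ?a x * ?b x + val_abs \<nu> l * ?b x + ?a x * val_abs \<nu> m) \<longlongrightarrow>
      0 * 0 + val_abs \<nu> l * 0 + 0 * val_abs \<nu> m) F"
    using assms unfolding limitin_val_topology_iff by (intro tendsto_intros)
  then show "((\<lambda>x. ?a x * ?b x + val_abs \<nu> l * ?b x + ?a x * val_abs \<nu> m) \<longlongrightarrow> 0) F" by simp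
qed

lemma limitin_val_topology_unique:
  "limitin (val_topology \<nu>) f l F \<Longrightarrow> limitin (val_topology \<nu>) f m F \<Longrightarrow> F \<noteq> bot \<Longrightarrow> l = m"
  by (rule val.limitin_metric_unique)

text \<open>In a complete ultrametric field, smallness of the terms off finite sets already gives
  summability. The limit along the sets \<open>C d\<close> is then also the unconditional one, hence
  the value picked by \<open>val_infsum\<close>.\<close>

lemma limitin_val_infsum:
  fixes f :: "'i \<Rightarrow> 'l" and C :: "nat \<Rightarrow> 'i set"
  assumes complete: "val_complete \<nu>"
    and C: "mono C" "\<And>d. finite (C d)" "\<And>d. C d \<subseteq> S"
    and small: "\<And>\<epsilon>. \<epsilon> > 0 \<Longrightarrow> \<exists>d. \<forall>x\<in>S - C d. val_abs \<nu> (f x) < \<epsilon>"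
  shows "limitin (val_topology \<nu>) (\<lambda>d. sum f (C d)) (val_infsum \<nu> f S) sequentially"
proof -
  \<comment> \<open>One estimate for all finite \<open>F\<close> containing \<open>C d\<close>
    serves both the Cauchy property of the sequence and the convergence over all finite
    subsets.\<close>
  have tail: "\<exists>D. \<forall>d\<ge>D. \<forall>F. finite F \<longrightarrow> C d \<subseteq> F \<longrightarrow> F \<subseteq> S \<longrightarrow> val_abs \<nu> (sum f F - sum f (C d)) < \<epsilon>"
    if \<epsilon>: "\<epsilon> > 0" for \<epsilon>
  proof -
    obtain D where D: "\<And>x. x \<in> S - C D \<Longrightarrow> val_abs \<nu> (f x) < \<epsilon>" using small[OF \<epsilon>] by blast
    have "val_abs \<nu> (sum f F - sum f (C d)) < \<epsilon>"
      if "D \<le> d" "finite F" "C d \<subseteq> F" "F \<subseteq> S" for d F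
    proof -
      have "sum f F - sum f (C d) = sum f (F - C d)" using that C(2) by (simp add: sum_diff)
      moreover have "val_abs \<nu> (sum f (F - C d)) < \<epsilon>"
        by (rule val_abs_sum_less[OF \<epsilon>]) (use D that monoD[OF C(1) \<open>D \<le> d\<close>] in blast)
      ultimately show ?thesis by simp
    qed
    then show ?thesis by blast
  qed
  have "val.MCauchy (\<lambda>d. sum f (C d))"
    unfolding val.MCauchy_def
  proof (intro conjI allI impI)
    fix \<epsilon> :: real assume "\<epsilon> > 0"
    from tail[OF this] obtain D where D: "\<And>d F. D \<le> d \<Longrightarrow> finite F \<Longrightarrow> C d \<subseteq> F \<Longrightarrow> F \<subseteq> S \<Longrightarrow>
        val_abs \<nu> (sum f F - sum f (C d)) < \<epsilon>" by blast
    have *: "val_dist \<nu> (sum f (C d)) (sum f (C d')) < \<epsilon>" if "D \<le> d" "d \<le> d'" for d d'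
      using D[OF that(1) C(2) monoD[OF C(1) that(2)] C(3)]
      by (subst val.commute) (simp add: val_dist_eq)
    have "val_dist \<nu> (sum f (C d)) (sum f (C d')) < \<epsilon>" if "D \<le> d" "D \<le> d'" for d d'
      using *[OF that(1), of d'] *[OF that(2), of d] val.commute[of "sum f (C d)"] nat_le_linear[of d d']
      by metis
    then show "\<exists>D. \<forall>d d'. D \<le> d \<longrightarrow> D \<le> d' \<longrightarrow> val_dist \<nu> (sum f (C d)) (sum f (C d')) < \<epsilon>" by blast
  qed simp
  then obtain l where l: "limitin (val_topology \<nu>) (\<lambda>d. sum f (C d)) l sequentially"
    using complete val.mcomplete_def by blast
  have "val_has_sum \<nu> f S l"
    unfolding val_has_sum_def val.limitin_metric
  proof (intro conjI allI impI)
    fix \<epsilon> :: real assume \<epsilon>: "\<epsilon> > 0"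
    from tail[OF \<epsilon>] obtain D where D: "\<And>d F. D \<le> d \<Longrightarrow> finite F \<Longrightarrow> C d \<subseteq> F \<Longrightarrow> F \<subseteq> S \<Longrightarrow>
        val_abs \<nu> (sum f F - sum f (C d)) < \<epsilon>" by blast
    obtain D' where D': "\<And>d. d \<ge> D' \<Longrightarrow> val_abs \<nu> (sum f (C d) - l) < \<epsilon>"
      using l \<epsilon> unfolding val.limit_metric_sequentially val_dist_eq by blast
    let ?d = "max D D'"
    have "val_dist \<nu> (sum f F) l < \<epsilon>" if F: "finite F" "C ?d \<subseteq> F" "F \<subseteq> S" for F
    proof -
      have "max (val_abs \<nu> (sum f F - sum f (C ?d))) (val_abs \<nu> (sum f (C ?d) - l)) < \<epsilon>"
        using D[OF _ F] D'[of ?d] by simp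
      with val_abs_add have "val_abs \<nu> ((sum f F - sum f (C ?d)) + (sum f (C ?d) - l)) < \<epsilon>"
        by (rule le_less_trans)
      then show ?thesis by (simp add: val_dist_eq)
    qed
    then show "\<forall>\<^sub>F F in finite_subsets_at_top S. sum f F \<in> UNIV \<and> val_dist \<nu> (sum f F) l < \<epsilon>"
      unfolding eventually_finite_subsets_at_top
      by (intro exI[of _ "C ?d"]) (simp add: C)
  qed simp
  \<comment> \<open>Uniqueness is needed because \<open>val_infsum\<close> is a definite
    description.\<close>
  moreover have "l' = l" if "val_has_sum \<nu> f S l'" for l'
    using that calculation unfolding val_has_sum_def
    by (rule limitin_val_topology_unique) simp
  ultimately have "val_infsum \<nu> f S = l"
    unfolding val_infsum_def by (rule the_equality)
  with l show ?thesis by simp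
qed

end

section \<open>Convergence of multiple sums\<close>

lemma prod_list_fun_apply: "prod_list fs a = (\<Prod>j<length fs. (fs ! j) a)"
  by (induction fs) (simp_all add: prod.lessThan_Suc_shift del: prod.lessThan_Suc)

definition bounded_chains :: "nat \<Rightarrow> nat \<Rightarrow> 'k::field poly list set" where
  "bounded_chains r d = {as \<in> monic_chains r. \<forall>a\<in>set as. degree a < d}"

lemma finite_bounded_chains: "finite (bounded_chains r d :: 'k::{field,finite} poly list set)"
proof (rule finite_subset)
  show "finite {as :: 'k poly list. set as \<subseteq> {a. degree a < d} \<and> length as = r}"
    by (rule finite_lists_length_eq[OF finite_degree_less])
qed (auto simp: bounded_chains_def monic_chains_def)

lemma bounded_chains_0: "bounded_chains 0 d = {[]}"
  by (auto simp: bounded_chains_def monic_chains_def)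

text \<open>Sort chains by the degree \<open>e\<close> of the head, which strictly bounds the
  degrees in the tail. This mirrors the recursion of \<open>partial_sum\<close>.\<close>

lemma bounded_chains_Suc:
  "bounded_chains (Suc r) d =
     (\<lambda>(e, a, as). a # as) ` (SIGMA e:{..<d}. monics e \<times> bounded_chains r e)"
proof (intro set_eqI iffI)
  fix x :: "'a poly list" assume "x \<in> bounded_chains (Suc r) d"
  then show "x \<in> (\<lambda>(e, a, as). a # as) ` (SIGMA e:{..<d}. monics e \<times> bounded_chains r e)"
    by (cases x) (auto simp: bounded_chains_def monic_chains_def monics_def
        intro!: rev_image_eqI[of "(degree (hd x), hd x, tl x)"])
qed (auto simp: bounded_chains_def monic_chains_def monics_def intro: less_trans)

context semi_character_sums
begin

text \<open>Shaped like the summand of \<open>f_A\<close> for the two projections of a word, so that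
  \<open>multiple_sum_eq\<close> holds by unfolding.\<close>

definition chain_term :: "(('k poly \<Rightarrow> 'l) \<times> nat) list \<Rightarrow> 'k poly list \<Rightarrow> 'l" where
  "chain_term w as = (\<Prod>j<length w. (map fst w ! j) (as ! j)) /
     (\<Prod>j<length w. \<gamma> (as ! j) ^ (map snd w ! j))"

lemma chain_term_Nil: "chain_term [] as = 1"
  by (simp add: chain_term_def)

lemma chain_term_Cons:
  "chain_term ((\<sigma>, n) # w) (a # as) = \<sigma> a / \<gamma> a ^ n * chain_term w as"
  by (simp add: chain_term_def prod.lessThan_Suc_shift del: prod.lessThan_Suc)

lemma sum_chain_term: "sum (chain_term w) (bounded_chains (length w) d) = partial_sum w d"
proof (induction w arbitrary: d)
  case Nil
  then show ?case by (simp add: bounded_chains_0 chain_term_Nil)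
next
  case (Cons x w)
  obtain \<sigma> n where x: "x = (\<sigma>, n)" by (cases x)
  have "sum (chain_term (x # w)) (bounded_chains (length (x # w)) d) =
      (\<Sum>(e, a, as)\<in>(SIGMA e:{..<d}. monics e \<times> bounded_chains (length w) e).
         \<sigma> a / \<gamma> a ^ n * chain_term w as)"
    unfolding length_Cons bounded_chains_Suc
    \<comment> \<open>The reindexing is injective because \<open>e\<close> is the degree of the head
      \<open>a\<close>.\<close>
    by (subst sum.reindex) (auto simp: inj_on_def x monics_def chain_term_Cons intro!: sum.cong)
  also have "\<dots> = (\<Sum>e<d. \<Sum>(a, as)\<in>monics e \<times> bounded_chains (length w) e.
         \<sigma> a / \<gamma> a ^ n * chain_term w as)"
    by (subst sum.Sigma) (auto simp: finite_bounded_chains)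
  also have "\<dots> = (\<Sum>e<d. power_sum_at \<sigma> n e * partial_sum w e)"
    by (simp add: power_sum_at_def Cons.IH[symmetric] sum_product sum.cartesian_product)
  finally show ?case by (simp add: x)
qed

definition multiple_sum :: "('l \<Rightarrow> rat extended) \<Rightarrow> (('k poly \<Rightarrow> 'l) \<times> nat) list \<Rightarrow> 'l" where
  "multiple_sum \<nu> w = f_A \<nu> \<gamma> (map fst w) (map snd w)"

lemma multiple_sum_eq: "multiple_sum \<nu> w = val_infsum \<nu> (chain_term w) (monic_chains (length w))"
  by (simp add: multiple_sum_def f_A_def chain_term_def[abs_def])

end

locale complete_semi_character_sums = semi_character_sums \<iota> I \<delta> \<gamma>
  for \<iota> :: "'k::{field, finite} \<Rightarrow> 'l::field" and I \<delta> \<gamma> +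
  fixes \<nu> :: "'l \<Rightarrow> rat extended"
  assumes valuation: "valuation \<nu>"
    and complete: "val_complete \<nu>"
    and \<nu>_\<delta>: "\<And>i a. i \<in> I \<Longrightarrow> \<nu> (\<delta> i a) \<in> {0, Pinf}"
    and \<gamma>_limit: "limitin (val_topology \<nu>) (\<lambda>a. inverse (\<gamma> a)) 0 (inf cofinite (principal (- {0})))"
begin

section \<open>Bounds on the terms and convergence\<close>

lemma val_abs_semi_character_le_1:
  assumes "\<sigma> \<in> semi_characters I \<delta>"
  shows "val_abs \<nu> (\<sigma> a) \<le> 1"
proof -
  \<comment> \<open>A value of 0 or infinity means absolute value 1 or 0.\<close>
  have "val_abs \<nu> (\<delta> i a) \<le> 1" if "i \<in> I" for i
    using \<nu>_\<delta>[OF that, of a] by (auto simp: val_abs_def val_dist_def zero_extended_def)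
  then show ?thesis
    using assms by (auto simp: semi_characters_eq monomial_def val_abs_prod[OF valuation]
        val_abs_power[OF valuation] val_abs_nonneg[OF valuation] intro!: prod_le_1 power_le_one)
qed

text \<open>The limit is taken along the cofinite filter on nonzero polynomials, so only finitely
  many of them can violate a given bound.\<close>

lemma finite_val_abs_inverse_\<gamma>:
  assumes "\<epsilon> > 0"
  shows "finite {a. a \<noteq> 0 \<and> \<epsilon> \<le> val_abs \<nu> (inverse (\<gamma> a))}"
proof -
  have "((\<lambda>a. val_abs \<nu> (inverse (\<gamma> a))) \<longlongrightarrow> 0) (inf cofinite (principal (- {0})))"
    using \<gamma>_limit by (simp add: limitin_val_topology_iff[OF valuation])
  then have "\<forall>\<^sub>F a in inf cofinite (principal (- {0})). val_abs \<nu> (inverse (\<gamma> a)) < \<epsilon>"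
    using assms by (rule order_tendstoD)
  then show ?thesis
    by (simp add: eventually_inf_principal eventually_cofinite not_less)
qed

lemma val_abs_inverse_\<gamma>_bounded:
  obtains K where "K \<ge> 1" and "\<And>a. a \<noteq> 0 \<Longrightarrow> val_abs \<nu> (inverse (\<gamma> a)) \<le> K"
proof -
  let ?X = "{a. a \<noteq> 0 \<and> 1 \<le> val_abs \<nu> (inverse (\<gamma> a))}"
  \<comment> \<open>Inserting 1 keeps the maximum defined when \<open>?X\<close> is empty and covers
    all polynomials outside \<open>?X\<close>.\<close>
  let ?K = "Max (insert 1 ((\<lambda>a. val_abs \<nu> (inverse (\<gamma> a))) ` ?X))"
  have fin: "finite ?X" by (rule finite_val_abs_inverse_\<gamma>) simp
  then have 1: "1 \<le> ?K" by (intro Max_ge) auto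
  have "val_abs \<nu> (inverse (\<gamma> a)) \<le> ?K" if "a \<noteq> 0" for a
  proof (cases "a \<in> ?X")
    case True
    then show ?thesis using fin by (intro Max_ge) auto
  next
    case False
    then show ?thesis using 1 that by (auto simp: not_le)
  qed
  with 1 show ?thesis by (rule that)
qed

lemma val_abs_letter_le:
  assumes "\<sigma> \<in> semi_characters I \<delta>"
  shows "val_abs \<nu> (\<sigma> a / \<gamma> a ^ n) \<le> val_abs \<nu> (inverse (\<gamma> a)) ^ n"
proof -
  have "val_abs \<nu> (\<sigma> a / \<gamma> a ^ n) = val_abs \<nu> (\<sigma> a) * val_abs \<nu> (inverse (\<gamma> a)) ^ n"
    by (simp add: divide_inverse val_abs_mult[OF valuation] power_inverse[symmetric]
        val_abs_power[OF valuation])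
  then show ?thesis
    using val_abs_semi_character_le_1[OF assms, of a]
    by (simp add: mult_left_le_one_le val_abs_nonneg[OF valuation])
qed

lemma val_abs_chain_term_le:
  assumes "\<forall>(\<sigma>, n)\<in>set w. \<sigma> \<in> semi_characters I \<delta>" and "length as = length w"
    and "0 \<notin> set as" and K: "\<And>a. a \<noteq> 0 \<Longrightarrow> val_abs \<nu> (inverse (\<gamma> a)) \<le> K"
  shows "val_abs \<nu> (chain_term w as) \<le> K ^ sum_list (map snd w)"
  using assms(2,1,3)
proof (induction as w rule: list_induct2)
  case Nil
  then show ?case by (simp add: chain_term_Nil val_abs_one[OF valuation])
next
  case (Cons a as x w)
  obtain \<sigma> n where x: "x = (\<sigma>, n)" by (cases x)
  have "val_abs \<nu> (\<sigma> a / \<gamma> a ^ n) \<le> val_abs \<nu> (inverse (\<gamma> a)) ^ n"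
    using Cons.prems x by (intro val_abs_letter_le) auto
  also have "\<dots> \<le> K ^ n"
    using Cons.prems by (intro power_mono K val_abs_nonneg[OF valuation]) auto
  finally have "val_abs \<nu> (\<sigma> a / \<gamma> a ^ n) \<le> K ^ n" .
  moreover have "val_abs \<nu> (chain_term w as) \<le> K ^ sum_list (map snd w)"
    using Cons by auto
  ultimately have "val_abs \<nu> (\<sigma> a / \<gamma> a ^ n) * val_abs \<nu> (chain_term w as) \<le>
      K ^ n * K ^ sum_list (map snd w)"
    by (rule mult_mono') (rule val_abs_nonneg[OF valuation])+
  then show ?case
    by (simp add: x chain_term_Cons val_abs_mult[OF valuation] power_add del: times_divide_eq_left)
qed

text \<open>The factor at the head tends to 0 as its degree grows, while the factors of the tail are
  bounded uniformly by a power of \<open>K\<close>.\<close>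

lemma chain_term_small:
  assumes w: "\<forall>(\<sigma>, n)\<in>set w. \<sigma> \<in> semi_characters I \<delta> \<and> n > 0" and \<epsilon>: "\<epsilon> > 0"
  shows "\<exists>d. \<forall>as\<in>monic_chains (length w) - bounded_chains (length w) d.
    val_abs \<nu> (chain_term w as) < \<epsilon>"
proof (cases w)
  case Nil
  then show ?thesis by (auto simp: bounded_chains_def monic_chains_def)
next
  case (Cons x v)
  obtain \<sigma> n where x: "x = (\<sigma>, n)" by (cases x)
  have \<sigma>: "\<sigma> \<in> semi_characters I \<delta>" "n > 0" and v: "\<forall>(\<sigma>, n)\<in>set v. \<sigma> \<in> semi_characters I \<delta>"
    using w by (auto simp: Cons x)
  obtain K where K: "K \<ge> 1" "\<And>a. a \<noteq> 0 \<Longrightarrow> val_abs \<nu> (inverse (\<gamma> a)) \<le> K"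
    using val_abs_inverse_\<gamma>_bounded by blast
  define B where "B = K ^ sum_list (map snd v)"
  have B: "B > 0" using K(1) by (simp add: B_def)
  \<comment> \<open>The bound 1 gives \<open>?g ^ n \<le> ?g\<close> for positive \<open>n\<close>;
    the bound \<open>\<epsilon> / B\<close> absorbs the tail.\<close>
  define \<eta> where "\<eta> = min 1 (\<epsilon> / B)"
  have \<eta>: "\<eta> > 0" using B \<epsilon> by (simp add: \<eta>_def)
  \<comment> \<open>Take \<open>d\<close> above the degrees of the finitely many exceptions.\<close>
  obtain d where d: "\<And>a. a \<noteq> 0 \<Longrightarrow> d \<le> degree a \<Longrightarrow> val_abs \<nu> (inverse (\<gamma> a)) < \<eta>"
    using finite_imageI[OF finite_val_abs_inverse_\<gamma>[OF \<eta>], of degree]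
    by (auto simp: finite_nat_set_iff_bounded not_le dest!: leD) (meson not_le)
  have "val_abs \<nu> (chain_term w as) < \<epsilon>"
    if as: "as \<in> monic_chains (length w) - bounded_chains (length w) d" for as
  proof -
    obtain a bs where abs: "as = a # bs" "length bs = length v"
      using as by (cases as) (auto simp: monic_chains_def Cons)
    \<comment> \<open>Outside \<open>bounded_chains\<close> some entry has degree at least
      \<open>d\<close>, and the head has the largest degree.\<close>
    have deg: "d \<le> degree a" and a: "a \<noteq> 0" and bs: "0 \<notin> set bs"
      using as by (force simp: abs monic_chains_def bounded_chains_def)+
    let ?g = "val_abs \<nu> (inverse (\<gamma> a))"
    have g: "?g < \<eta>" by (rule d[OF a deg])
    have "val_abs \<nu> (\<sigma> a / \<gamma> a ^ n) \<le> ?g ^ n" by (rule val_abs_letter_le[OF \<sigma>(1)])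
    also have "\<dots> \<le> ?g ^ 1"
      using g \<sigma>(2) by (intro power_decreasing val_abs_nonneg[OF valuation]) (auto simp: \<eta>_def)
    finally have "val_abs \<nu> (\<sigma> a / \<gamma> a ^ n) * val_abs \<nu> (chain_term v bs) \<le> ?g * B"
      unfolding B_def
      using val_abs_chain_term_le[OF v abs(2) bs K(2)] val_abs_nonneg[OF valuation]
      by (intro mult_mono) auto
    also have "\<dots> < \<epsilon>" using g B by (simp add: \<eta>_def pos_less_divide_eq)
    finally show ?thesis
      by (simp add: Cons x abs chain_term_Cons val_abs_mult[OF valuation] del: times_divide_eq_left)
  qed
  then show ?thesis by blast
qed

lemma limitin_partial_sum:
  assumes "\<forall>(\<sigma>, n)\<in>set w. \<sigma> \<in> semi_characters I \<delta> \<and> n > 0"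
  shows "limitin (val_topology \<nu>) (partial_sum w) (multiple_sum \<nu> w) sequentially"
proof -
  have "limitin (val_topology \<nu>) (\<lambda>d. sum (chain_term w) (bounded_chains (length w) d))
      (val_infsum \<nu> (chain_term w) (monic_chains (length w))) sequentially"
  proof (rule limitin_val_infsum[OF valuation complete])
    show "mono (bounded_chains (length w) :: nat \<Rightarrow> 'k poly list set)"
      by (force simp: mono_def bounded_chains_def)
    show "finite (bounded_chains (length w) d :: 'k poly list set)" for d
      by (rule finite_bounded_chains)
    show "bounded_chains (length w) d \<subseteq> monic_chains (length w)" for d
      by (auto simp: bounded_chains_def)
  qed (rule chain_term_small[OF assms])
  then show ?thesis by (simp add: sum_chain_term multiple_sum_eq)
qed

section \<open>Passage to the limit in the product formula\<close>

lemma F_space_eq: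
  assumes "n > 0"
  shows "F_space \<nu> I \<delta> \<gamma> n \<sigma> = group_closure (multiple_sum \<nu> ` (\<Union>k. words k n \<sigma>))"
proof -
  have "{f_A \<nu> \<gamma> \<sigma>s ns | \<sigma>s ns.
      \<sigma>s \<noteq> [] \<and> length ns = length \<sigma>s \<and> set \<sigma>s \<subseteq> semi_characters I \<delta> \<and>
      (\<lambda>a. \<Prod>j<length \<sigma>s. (\<sigma>s ! j) a) = \<sigma> \<and> sum_list ns = n \<and> (\<forall>k\<in>set ns. k > 0)} =
    multiple_sum \<nu> ` (\<Union>k. words k n \<sigma>)" (is "?A = ?B")
  proof (intro set_eqI iffI)
    fix x assume "x \<in> ?A"
    then obtain \<sigma>s ns where *: "x = f_A \<nu> \<gamma> \<sigma>s ns" "length ns = length \<sigma>s"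
      "set \<sigma>s \<subseteq> semi_characters I \<delta>" "(\<lambda>a. \<Prod>j<length \<sigma>s. (\<sigma>s ! j) a) = \<sigma>"
      "sum_list ns = n" "\<forall>k\<in>set ns. k > 0" by blast
    have "prod_list \<sigma>s = \<sigma>" using *(4) by (simp add: fun_eq_iff prod_list_fun_apply)
    then have "zip \<sigma>s ns \<in> words (length \<sigma>s) n \<sigma>"
      using * by (auto simp: words_def dest: set_zip_leftD set_zip_rightD)
    moreover have "x = multiple_sum \<nu> (zip \<sigma>s ns)" using * by (simp add: multiple_sum_def)
    ultimately show "x \<in> ?B" by blast
  next
    fix x assume "x \<in> ?B"
    then obtain k w where w: "w \<in> words k n \<sigma>" and x: "x = multiple_sum \<nu> w" by blast
    have "(\<lambda>a. \<Prod>j<length (map fst w). (map fst w ! j) a) = \<sigma>"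
      using w by (simp only: words_def mem_Collect_eq prod_list_fun_apply[symmetric])
    \<comment> \<open>The positive weight \<open>n\<close> excludes the empty word.\<close>
    moreover have "map fst w \<noteq> []" "set (map fst w) \<subseteq> semi_characters I \<delta>"
      "sum_list (map snd w) = n" "\<forall>k\<in>set (map snd w). k > 0"
      using w assms by (auto simp: words_def)
    moreover have "length (map snd w) = length (map fst w)" by simp
    ultimately show "x \<in> ?A" unfolding x multiple_sum_def by blast
  qed
  then show ?thesis
    using assms by (simp add: F_space_def Fp_span_eq_group_closure)
qed

text \<open>Generators converge to multiple sums, and limits respect differences, so the integer
  combination carries over to the limit.\<close>

lemma limitin_partial_sum_space:
  assumes "f \<in> partial_sum_space k n \<sigma>" and "n > 0"
  shows "\<exists>l\<in>F_space \<nu> I \<delta> \<gamma> n \<sigma>. limitin (val_topology \<nu>) f l sequentially"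
  using assms(1)
proof induction
  case (base f)
  then consider "f = 0" | w where "w \<in> words k n \<sigma>" "f = partial_sum w" by auto
  then show ?case
  proof cases
    case 1
    moreover have "limitin (val_topology \<nu>) 0 0 sequentially"
      by (simp add: limitin_val_topology_iff[OF valuation] val_abs_zero[OF valuation])
    moreover have "0 \<in> F_space \<nu> I \<delta> \<gamma> n \<sigma>" by (simp add: F_space_eq[OF assms(2)])
    ultimately show ?thesis by blast
  next
    case 2
    then have "limitin (val_topology \<nu>) f (multiple_sum \<nu> w) sequentially"
      by (auto simp: words_def intro!: limitin_partial_sum)
    moreover have "multiple_sum \<nu> w \<in> F_space \<nu> I \<delta> \<gamma> n \<sigma>"
      unfolding F_space_eq[OF assms(2)] using 2 by (blast intro: group_closure_superset)
    ultimately show ?thesis by blast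
  qed
next
  case (diff f g)
  then obtain l m where "l \<in> F_space \<nu> I \<delta> \<gamma> n \<sigma>" "m \<in> F_space \<nu> I \<delta> \<gamma> n \<sigma>"
    "limitin (val_topology \<nu>) f l sequentially" "limitin (val_topology \<nu>) g m sequentially"
    by blast
  then show ?case
    using limitin_val_topology_diff[OF valuation]
    unfolding F_space_eq[OF assms(2)] by (blast intro: group_closure.diff)
qed

text \<open>By bilinearity two multiple sums suffice. The product of their truncations tends to the
  product of their values and, by \<open>partial_sum_mult\<close>, to an element of the target
  space; limits are unique.\<close>

lemma F_space_mult:
  assumes x: "x \<in> F_space \<nu> I \<delta> \<gamma> m \<sigma>" and y: "y \<in> F_space \<nu> I \<delta> \<gamma> n \<psi>" and "m > 0" "n > 0"
  shows "x * y \<in> F_space \<nu> I \<delta> \<gamma> (m + n) (\<sigma> * \<psi>)"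
proof -
  have "multiple_sum \<nu> u * multiple_sum \<nu> v \<in> F_space \<nu> I \<delta> \<gamma> (m + n) (\<sigma> * \<psi>)"
    if u: "u \<in> words k m \<sigma>" and v: "v \<in> words l n \<psi>" for u v k l
  proof -
    obtain z where z: "z \<in> F_space \<nu> I \<delta> \<gamma> (m + n) (\<sigma> * \<psi>)"
      "limitin (val_topology \<nu>) (partial_sum u * partial_sum v) z sequentially"
      using limitin_partial_sum_space[OF partial_sum_mult[OF u v]] assms by auto
    have "limitin (val_topology \<nu>) (partial_sum u * partial_sum v)
        (multiple_sum \<nu> u * multiple_sum \<nu> v) sequentially"
      by (intro limitin_val_topology_mult[OF valuation] limitin_partial_sum)
        (use u v in \<open>auto simp: words_def\<close>)
    then have "multiple_sum \<nu> u * multiple_sum \<nu> v = z"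
      using z(2) by (rule limitin_val_topology_unique[OF valuation]) simp
    with z(1) show ?thesis by simp
  qed
  then show ?thesis
    using x y assms(3,4) by (auto simp: F_space_eq elim!: group_closure_mult)
qed

section \<open>The algebra spanned by all multiple sums\<close>

lemma Fp_subspace_F_total: "Fp_subspace (F_total \<nu> I \<delta> \<gamma>)"
  by (auto simp: F_total_def Fp_span_eq_group_closure Fp_subspace_def Fp_def
      intro: group_closure_add group_closure_of_int_mult)

lemma F_space_subset_F_total:
  "\<sigma> \<in> semi_characters I \<delta> \<Longrightarrow> x \<in> F_space \<nu> I \<delta> \<gamma> n \<sigma> \<Longrightarrow> x \<in> F_total \<nu> I \<delta> \<gamma>"
  by (auto simp: F_total_def Fp_span_eq_group_closure intro!: group_closure_superset)

text \<open>Reduces products with a factor of weight 0 to scalar multiplication, since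
  \<open>F_space_mult\<close> concerns positive weights.\<close>

lemma F_space_0_subset: "F_space \<nu> I \<delta> \<gamma> 0 \<sigma> \<subseteq> Fp"
  by (auto simp: F_space_def Fp_def intro: range_eqI[of _ _ 0])

lemma Fp_subalgebra_F_total: "Fp_subalgebra (F_total \<nu> I \<delta> \<gamma>)"
proof -
  let ?T = "F_total \<nu> I \<delta> \<gamma>"
  have scale: "c * x \<in> ?T" "x * c \<in> ?T" if "c \<in> Fp" "x \<in> ?T" for c x
    using that Fp_subspace_F_total by (auto simp: Fp_subspace_def mult.commute)
  have "1 \<in> F_space \<nu> I \<delta> \<gamma> 0 1"
    by (auto simp: F_space_def Fp_def one_fun_def intro: range_eqI[of _ _ 1])
  then have one: "1 \<in> ?T" by (rule F_space_subset_F_total[OF one_in_semi_characters])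
  have "x * y \<in> ?T"
    if x: "x \<in> F_space \<nu> I \<delta> \<gamma> m \<sigma>" "\<sigma> \<in> semi_characters I \<delta>"
      and y: "y \<in> F_space \<nu> I \<delta> \<gamma> n \<psi>" "\<psi> \<in> semi_characters I \<delta>" for x y m n \<sigma> \<psi>
  proof -
    consider "m = 0" | "n = 0" | "m > 0" "n > 0" by blast
    then show ?thesis
    proof cases
      case 1
      then show ?thesis using x y F_space_0_subset by (blast intro: scale F_space_subset_F_total)
    next
      case 2
      then show ?thesis using x y F_space_0_subset by (blast intro: scale F_space_subset_F_total)
    next
      case 3
      then show ?thesis
        using F_space_mult[OF x(1) y(1)] F_space_subset_F_total mult_in_semi_characters[OF x(2) y(2)]
        by blast
    qed
  qed
  then have "x * y \<in> ?T" if "x \<in> ?T" "y \<in> ?T" for x y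
    using that unfolding F_total_def Fp_span_eq_group_closure
    by (elim group_closure_mult) auto
  with one Fp_subspace_F_total show ?thesis by (simp add: Fp_subalgebra_def)
qed

end

theorem theorem9p4:
  fixes p q e :: nat
    and \<iota> :: "'k::{field, finite} \<Rightarrow> 'l::field"
    and \<nu> :: "'l \<Rightarrow> rat extended"
    and I :: "nat set"
    and \<delta> :: "nat \<Rightarrow> 'k poly \<Rightarrow> 'l"
    and \<gamma> :: "'k poly \<Rightarrow> 'l"
  assumes "prime p" and "e \<ge> 1" and "q = p ^ e" and "CARD('k) = q"
    and "field_embedding \<iota>"
    and "valuation \<nu>" and "val_complete \<nu>"
    and "finite I" and "0 \<notin> I"
    and "\<And>i. i \<in> I \<Longrightarrow> Vector_Spaces.linear smult (\<lambda>c x. \<iota> c * x) (\<delta> i)"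
    and "\<And>i. i \<in> I \<Longrightarrow> inj (\<delta> i)"
    and "Vector_Spaces.linear smult (\<lambda>c x. \<iota> c * x) \<gamma>"
    and "inj \<gamma>"
    and "\<And>i a. i \<in> I \<Longrightarrow> \<nu> (\<delta> i a) \<in> {0, Pinf}"
    and "limitin (val_topology \<nu>) (\<lambda>a. inverse (\<gamma> a)) 0 (inf cofinite (principal (- {0})))"
  shows "(\<forall>m n. \<forall>\<sigma>\<in>semi_characters I \<delta>. \<forall>\<psi>\<in>semi_characters I \<delta>. m > 0 \<longrightarrow> n > 0 \<longrightarrow>
            {x * y | x y. x \<in> F_space \<nu> I \<delta> \<gamma> m \<sigma> \<and> y \<in> F_space \<nu> I \<delta> \<gamma> n \<psi>}
              \<subseteq> F_space \<nu> I \<delta> \<gamma> (m + n) (\<lambda>a. \<sigma> a * \<psi> a))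
         \<and> Fp_subalgebra (F_total \<nu> I \<delta> \<gamma>)"
proof -
  interpret complete_semi_character_sums \<iota> I \<delta> \<gamma> \<nu>
    by (intro complete_semi_character_sums.intro semi_character_sums.intro
        complete_semi_character_sums_axioms.intro assms)
  show ?thesis
    using F_space_mult Fp_subalgebra_F_total by (auto simp: times_fun_def)
qed

end
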